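(* Let $\beta>0$, $T\in(0,1)$ and $\xi_T:=\mathcal J(T)-1$. The sequence $\{n^{-1}\log\Delta^{L,\beta}_n(T)\}_n$ satisfies an LDP in $\mathbb R$ in the scale $2\beta^{-1}n^{-2}$ with good rate function $I^L_T$ given by: (1) if $\xi\ge\xi_T$, the equation $\mathcal J(1+\theta)-\mathcal J(1-T+\theta)=\xi$ has a unique solution $\theta\ge-(1-T)$ and $I^L_T(\xi)=\theta\xi+F(1)-F(1-T)-F(1+\theta)+F(1-T+\theta)$; (2) if $\xi<\xi_T$, $I^L_T(\xi)=I^L_T(\xi_T)+(1-T)(\xi_T-\xi)$.
   Context: $\beta'=\beta/2$; $\rho^{L,\beta}_{k,n}$ ($1\le k\le n$) independent, $\rho^{L,\beta}_{k,n}\sim\mathrm{Gamma}(\beta'(n-k+1),1/2)$ (shape, rate); $\log\Delta^{L,\beta}_n(T)=\sum_{k=1}^{\lfloor nT\rfloor}\log\frac{\rho^{L,\beta}_{k,n}}{\beta n}$. $\mathcal J(u)=u\log u-u+1$ ($u>0$), $\mathcal J(0)=1$; $F(t)=\frac{t^2}2\log t-\frac{3t^2}4+t$ for $t\ge0$, $F(0)=0$. LDP in scale $2\beta^{-1}n^{-2}$ means speed $\beta n^2/2$. *)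

theory Defs
  imports "HOL-Probability.Probability"
begin

definition gamma_density :: "real \<Rightarrow> real \<Rightarrow> real \<Rightarrow> ennreal" where
  "gamma_density k r x =
     (if x > 0 then ennreal (r powr k * x powr (k - 1) * exp (- r * x) / Gamma k) else 0)"

definition ereal_ln :: "real \<Rightarrow> ereal" where
  "ereal_ln p = (if p \<le> 0 then -\<infinity> else ereal (ln p))"

definition good_rate_function :: "(real \<Rightarrow> ereal) \<Rightarrow> bool" where
  "good_rate_function I \<longleftrightarrow> (\<forall>x. I x \<ge> 0) \<and> (\<forall>c::real. compact {x. I x \<le> ereal c})"

definition LDP :: "(nat \<Rightarrow> real measure) \<Rightarrow> (nat \<Rightarrow> real) \<Rightarrow> (real \<Rightarrow> ereal) \<Rightarrow> bool" where
  "LDP mu a I \<longleftrightarrow> good_rate_function I \<and>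
     (\<forall>F. closed F \<longrightarrow>
        limsup (\<lambda>n. ereal_ln (measure (mu n) F) * ereal (1 / a n)) \<le> - (INF x\<in>F. I x)) \<and>
     (\<forall>G. open G \<longrightarrow>
        liminf (\<lambda>n. ereal_ln (measure (mu n) G) * ereal (1 / a n)) \<ge> - (INF x\<in>G. I x))"

definition J_fun :: "real \<Rightarrow> real" where
  "J_fun u = (if u = 0 then 1 else u * ln u - u + 1)"

definition F_fun :: "real \<Rightarrow> real" where
  "F_fun t = (if t = 0 then 0 else t\<^sup>2 / 2 * ln t - 3 * t\<^sup>2 / 4 + t)"

definition logDelta_scaled ::
    "real \<Rightarrow> real \<Rightarrow> (nat \<Rightarrow> nat \<Rightarrow> 'a \<Rightarrow> real) \<Rightarrow> nat \<Rightarrow> 'a \<Rightarrow> real" where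
  "logDelta_scaled \<beta> T \<rho> n \<omega> =
     (1 / real n) * (\<Sum>k = 1..nat \<lfloor>real n * T\<rfloor>. ln (\<rho> n k \<omega> / (\<beta> * real n)))"

end

(* The log-moment generating function at speed times \<theta> is a sum of differences of ln_Gamma.
   Stirling's main term z * ln z - z turns it into a Riemann sum of J_fun, so that, divided by the
   speed, it tends to
     L \<theta> = F_fun (1 + \<theta>) - F_fun (1 - T + \<theta>) - F_fun 1 + F_fun (1 - T)
   for \<theta> \<ge> \<theta>\<^sub>0 = -(1 - T), while it is infinite beyond \<theta>\<^sub>0.  The rate function is the
   Legendre transform of L.  The upper bound is Chernoff's inequality at the optimal \<theta>.  Because the
   derivative of L stays bounded at \<theta>\<^sub>0, the Gaertner-Ellis lower bound only reaches values above
   J_fun T - 1.  The remaining values are attained by making the last, smallest gamma variable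
   exponentially small, which has the linear cost 1 - T; applied to values above J_fun T - 1 as
   well, this device treats all cases at once. *)

theory Submission
  imports Defs "HOL-Real_Asymp.Real_Asymp"
begin

section \<open>The limiting cumulant function and its Legendre transform\<close>

text \<open>The endpoint \<open>\<theta>\<^sub>0\<close> comes from the smallest variable: with
  \<open>b = \<beta> / 2\<close> its shape is about \<open>b * n * (1 - T)\<close>, and its moment
  of order \<open>b * n * \<theta>\<close> is finite only while shape plus order is positive. The
  same exponent explains the linear cost: a gamma variable of shape \<open>\<kappa>\<close> lies
  below a small \<open>u\<close> with probability of order \<open>u powr \<kappa>\<close>, so level
  \<open>exp (- n * c)\<close> costs \<open>b * n\<^sup>2 * (1 - T) * c\<close>. Omitting one of
  about \<open>n * T\<close> variables does not change the limit \<open>L\<close>, and the remaining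
  average is independent of the omitted term; the lower bound multiplies the two probabilities.
  Hence the exponential estimates are stated for an abstract sequence \<open>Y\<close> and used for
  both averages. Stirling's error is logarithmic per summand, thus of order \<open>n * ln n\<close>
  in total, which is negligible at a speed of order \<open>n\<^sup>2\<close>. Rounding
  \<open>n * T\<close> down keeps every argument of \<open>ln_Gamma\<close> at least
  \<open>b\<close>, even at \<open>\<theta>\<^sub>0\<close>, so the endpoint itself is an admissible
  tilt.\<close>

lemma J_fun_eq: "J_fun u = u * ln u - u + 1"
  by (simp add: J_fun_def)

text \<open>The convention \<open>ln 0 = 0\<close> makes both closed forms agree with the prescribed
  values at 0.\<close>

lemma F_fun_eq: "F_fun t = t\<^sup>2 / 2 * ln t - 3 * t\<^sup>2 / 4 + t"
  by (simp add: F_fun_def)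

lemma J_fun_has_derivative:
  "u > 0 \<Longrightarrow> (J_fun has_real_derivative ln u) (at u)"
  unfolding J_fun_eq[abs_def] by (auto intro!: derivative_eq_intros)

lemma F_fun_has_derivative:
  "t > 0 \<Longrightarrow> (F_fun has_real_derivative J_fun t) (at t)"
  unfolding F_fun_eq[abs_def] J_fun_eq
  by (auto intro!: derivative_eq_intros simp: power2_eq_square field_simps)

text \<open>Continuity up to 0 is what admits the tilt \<open>\<theta>\<^sub>0\<close>, where the
  argument \<open>1 - T + \<theta>\<close> vanishes.\<close>

lemma continuous_on_nonneg_if_DERIV:
  fixes f f' :: "real \<Rightarrow> real"
  assumes deriv: "\<And>t. t > 0 \<Longrightarrow> (f has_real_derivative f' t) (at t)"
    and zero: "(f \<longlongrightarrow> f 0) (at_right 0)"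
  shows "continuous_on {0..} f"
  unfolding continuous_on_eq_continuous_within
proof
  fix x :: real assume "x \<in> {0..}"
  then consider "x = 0" | "x > 0" by force
  then show "continuous (at x within {0..}) f"
  proof cases
    case 1
    with zero show ?thesis by (simp add: continuous_within at_within_Ici_at_right)
  next
    case 2
    with deriv DERIV_isCont continuous_at_imp_continuous_at_within show ?thesis by blast
  qed
qed

lemma continuous_on_J_fun: "continuous_on {0..} J_fun"
proof (rule continuous_on_nonneg_if_DERIV[OF J_fun_has_derivative])
  show "(J_fun \<longlongrightarrow> J_fun 0) (at_right 0)"
    unfolding J_fun_eq[abs_def] by simp real_asymp
qed

lemma continuous_on_F_fun: "continuous_on {0..} F_fun"
proof (rule continuous_on_nonneg_if_DERIV[OF F_fun_has_derivative])
  show "(F_fun \<longlongrightarrow> F_fun 0) (at_right 0)"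
    unfolding F_fun_eq[abs_def] by simp real_asymp
qed

section \<open>The limiting cumulant function \<open>L\<close>, its derivative \<open>D\<close> and
  the Legendre transform \<open>rate\<close>\<close>

locale window =
  fixes T :: real
  assumes T_pos: "0 < T" and T_less_1: "T < 1"
begin

definition \<theta>\<^sub>0 :: real where "\<theta>\<^sub>0 = -(1 - T)"

definition L :: "real \<Rightarrow> real" where
  "L \<theta> = F_fun (1 + \<theta>) - F_fun (1 - T + \<theta>) - F_fun 1 + F_fun (1 - T)"

text \<open>The derivative of \<open>L\<close>: stationarity of
  \<open>\<theta> * \<xi> - L \<theta>\<close> in \<open>\<theta>\<close> is the equation
  \<open>D \<theta> = \<xi>\<close> of the theorem.\<close>

definition D :: "real \<Rightarrow> real" where
  "D \<theta> = J_fun (1 + \<theta>) - J_fun (1 - T + \<theta>)"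

text \<open>The threshold of the theorem is the one-sided slope of \<open>L\<close> at its left
  endpoint, finite because \<open>J_fun 0 = 1\<close>.\<close>

lemma D_\<theta>\<^sub>0: "D \<theta>\<^sub>0 = J_fun T - 1"
  by (simp add: D_def \<theta>\<^sub>0_def J_fun_def[of 0])

lemma L_0: "L 0 = 0"
  by (simp add: L_def)

lemma continuous_on_L: "continuous_on {\<theta>\<^sub>0..} L"
  unfolding L_def using T_pos
  by (intro continuous_intros continuous_on_compose2[OF continuous_on_F_fun]) (auto simp: \<theta>\<^sub>0_def)

lemma continuous_on_D: "continuous_on {\<theta>\<^sub>0..} D"
  unfolding D_def using T_pos
  by (intro continuous_intros continuous_on_compose2[OF continuous_on_J_fun]) (auto simp: \<theta>\<^sub>0_def)

lemma L_has_derivative: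
  assumes "\<theta> > \<theta>\<^sub>0" shows "(L has_real_derivative D \<theta>) (at \<theta>)"
proof -
  have "1 + \<theta> > 0" "1 - T + \<theta> > 0" using assms T_pos by (auto simp: \<theta>\<^sub>0_def)
  then show ?thesis
    unfolding L_def D_def
    by (auto intro!: derivative_eq_intros DERIV_chain2[OF F_fun_has_derivative])
qed

lemma D_has_derivative:
  assumes "\<theta> > \<theta>\<^sub>0"
  shows "(D has_real_derivative ln (1 + \<theta>) - ln (1 - T + \<theta>)) (at \<theta>)"
proof -
  have "1 + \<theta> > 0" "1 - T + \<theta> > 0" using assms T_pos by (auto simp: \<theta>\<^sub>0_def)
  then show ?thesis
    unfolding D_def
    by (auto intro!: derivative_eq_intros DERIV_chain2[OF J_fun_has_derivative])
qed

text \<open>Since \<open>T > 0\<close>, the derivative of \<open>D\<close> is positive, so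
  \<open>L\<close> is strictly convex. That derivative blows up at \<open>\<theta>\<^sub>0\<close>,
  where only continuity of \<open>D\<close> is available.\<close>

lemma D_strict_mono:
  assumes "\<theta>\<^sub>0 \<le> x" "x < y" shows "D x < D y"
proof (rule DERIV_pos_imp_increasing_open[where f = D])
  fix z assume "x < z" "z < y"
  then have "z > \<theta>\<^sub>0" using assms by simp
  moreover from this have "ln (1 - T + z) < ln (1 + z)"
    using T_pos by (subst ln_less_cancel_iff) (auto simp: \<theta>\<^sub>0_def)
  ultimately show "\<exists>l. (D has_real_derivative l) (at z) \<and> 0 < l"
    using D_has_derivative by force
next
  show "continuous_on {x..y} D"
    by (rule continuous_on_subset[OF continuous_on_D]) (use assms in auto)
qed fact

lemma D_mono: "\<theta>\<^sub>0 \<le> x \<Longrightarrow> x \<le> y \<Longrightarrow> D x \<le> D y"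
  using D_strict_mono[of x y] by (cases "x = y") auto

lemma D_le_iff: "\<theta>\<^sub>0 \<le> x \<Longrightarrow> \<theta>\<^sub>0 \<le> y \<Longrightarrow> D x \<le> D y \<longleftrightarrow> x \<le> y"
  using D_strict_mono[of y x] D_mono[of x y] by (meson linorder_not_less)

lemma D_unbounded: "\<exists>\<theta>\<ge>\<theta>\<^sub>0. D \<theta> \<ge> \<xi>"
proof -
  \<comment> \<open>By the mean value theorem \<open>D \<theta> = T * ln z\<close> with
    \<open>z > 1 - T + \<theta>\<close>; this shift forces
    \<open>z > exp (\<xi> / T)\<close>.\<close>
  define \<theta> where "\<theta> = \<theta>\<^sub>0 + max 1 (exp (\<xi> / T))"
  define t where "t = 1 - T + \<theta>"
  have t: "t = max 1 (exp (\<xi> / T))" by (simp add: t_def \<theta>_def \<theta>\<^sub>0_def)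
  then have "t > 0" by simp
  have "\<exists>z. t < z \<and> z < t + T \<and> J_fun (t + T) - J_fun t = (t + T - t) * ln z"
    using T_pos \<open>t > 0\<close> by (intro MVT2) (auto intro!: J_fun_has_derivative)
  then obtain z where z: "z > t" "D \<theta> = T * ln z" by (auto simp: D_def t_def add_ac)
  have "\<xi> / T = ln (exp (\<xi> / T))" by simp
  also have "\<dots> \<le> ln z" using z t by (subst ln_le_cancel_iff) auto
  finally have "\<xi> \<le> D \<theta>" using z T_pos by (simp add: field_simps)
  then show ?thesis by (intro exI[of _ \<theta>]) (auto simp: \<theta>_def)
qed

lemma D_ex1:
  assumes "\<xi> \<ge> D \<theta>\<^sub>0" shows "\<exists>!\<theta>. \<theta> \<ge> \<theta>\<^sub>0 \<and> D \<theta> = \<xi>"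
proof -
  obtain u where u: "u \<ge> \<theta>\<^sub>0" "D u \<ge> \<xi>" using D_unbounded by blast
  then have "\<exists>x\<ge>\<theta>\<^sub>0. x \<le> u \<and> D x = \<xi>"
    by (intro IVT') (auto intro: assms continuous_on_subset[OF continuous_on_D])
  then show ?thesis using D_strict_mono by (metis linorder_neq_iff)
qed

text \<open>The maximiser of \<open>\<theta> * \<xi> - L \<theta>\<close> over
  \<open>\<theta> \<ge> \<theta>\<^sub>0\<close>. Below the threshold that function decreases in
  \<open>\<theta>\<close> and is largest at the endpoint, which \<open>max\<close> encodes; so a
  single formula for \<open>rate\<close> covers both cases of the theorem.\<close>

definition \<tau> :: "real \<Rightarrow> real" where
  "\<tau> \<xi> = (THE \<theta>. \<theta> \<ge> \<theta>\<^sub>0 \<and> D \<theta> = max \<xi> (D \<theta>\<^sub>0))"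

definition rate :: "real \<Rightarrow> real" where
  "rate \<xi> = \<tau> \<xi> * \<xi> - L (\<tau> \<xi>)"

lemma \<tau>: "\<tau> \<xi> \<ge> \<theta>\<^sub>0" "D (\<tau> \<xi>) = max \<xi> (D \<theta>\<^sub>0)"
  using theI'[OF D_ex1[of "max \<xi> (D \<theta>\<^sub>0)"]] unfolding \<tau>_def by auto

lemma \<tau>_eqI: "\<theta> \<ge> \<theta>\<^sub>0 \<Longrightarrow> D \<theta> = max \<xi> (D \<theta>\<^sub>0) \<Longrightarrow> \<tau> \<xi> = \<theta>"
  using D_ex1[of "max \<xi> (D \<theta>\<^sub>0)"] \<tau> by auto

lemma \<tau>_below: "\<xi> \<le> D \<theta>\<^sub>0 \<Longrightarrow> \<tau> \<xi> = \<theta>\<^sub>0"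
  by (rule \<tau>_eqI) auto

lemma \<tau>_mono: "x \<le> y \<Longrightarrow> \<tau> x \<le> \<tau> y"
  by (subst D_le_iff[symmetric]) (auto simp: \<tau>)

text \<open>\<open>D 0\<close> is the typical value: the optimal tilt vanishes there, and its sign
  on either side selects the Chernoff bound for the lower or the upper tail.\<close>

lemma \<tau>_D_0: "\<tau> (D 0) = 0"
  using T_less_1 by (intro \<tau>_eqI) (auto simp: \<theta>\<^sub>0_def intro!: max_absorb1[symmetric] D_mono)

text \<open>Convexity of \<open>L\<close>, from the mean value theorem and monotonicity of
  \<open>D\<close>; in this form it includes the endpoint, where only continuity of \<open>L\<close>
  enters.\<close>

lemma L_tangent:
  assumes "\<theta> \<ge> \<theta>\<^sub>0" "\<theta>' \<ge> \<theta>\<^sub>0"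
  shows "L \<theta> \<ge> L \<theta>' + (\<theta> - \<theta>') * D \<theta>'"
proof -
  have mvt: "\<exists>z>x. z < y \<and> L y - L x = (y - x) * D z" if "\<theta>\<^sub>0 \<le> x" "x < y" for x y
  proof -
    have "\<exists>l z. x < z \<and> z < y \<and> DERIV L z :> l \<and> L y - L x = (y - x) * l"
      using that by (intro MVT continuous_on_subset[OF continuous_on_L])
        (auto simp: real_differentiable_def intro!: exI L_has_derivative)
    then obtain l z where z: "x < z" "z < y" "DERIV L z :> l" "L y - L x = (y - x) * l" by blast
    then have "l = D z" using that by (intro DERIV_unique[OF _ L_has_derivative]) auto
    with z show ?thesis by blast
  qed
  consider "\<theta> = \<theta>'" | "\<theta>' < \<theta>" | "\<theta> < \<theta>'" by linarith
  then show ?thesis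
  proof cases
    case 2
    with mvt assms obtain z where z: "z > \<theta>'" "L \<theta> - L \<theta>' = (\<theta> - \<theta>') * D z" by blast
    have "(\<theta> - \<theta>') * D \<theta>' \<le> (\<theta> - \<theta>') * D z"
      using z 2 assms by (intro mult_left_mono D_mono) auto
    with z show ?thesis by linarith
  next
    case 3
    with mvt assms obtain z where z: "z > \<theta>" "z < \<theta>'" "L \<theta>' - L \<theta> = (\<theta>' - \<theta>) * D z" by blast
    have "(\<theta>' - \<theta>) * D z \<le> (\<theta>' - \<theta>) * D \<theta>'"
      using z 3 assms by (intro mult_left_mono D_mono) auto
    with z show ?thesis by (simp add: algebra_simps)
  qed simp
qed

lemma rate_ge:
  assumes "\<theta> \<ge> \<theta>\<^sub>0" shows "rate \<xi> \<ge> \<theta> * \<xi> - L \<theta>"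
proof -
  \<comment> \<open>Complementary slackness: either \<open>D (\<tau> \<xi>) = \<xi>\<close>, or
    \<open>\<tau> \<xi>\<close> is the left endpoint and \<open>\<xi>\<close> lies below the slope
    there.\<close>
  have "(\<theta> - \<tau> \<xi>) * (\<xi> - D (\<tau> \<xi>)) \<le> 0"
  proof (cases "\<xi> \<ge> D \<theta>\<^sub>0")
    case True
    then show ?thesis by (simp add: \<tau>)
  next
    case False
    then have "\<tau> \<xi> = \<theta>\<^sub>0" by (simp add: \<tau>_below)
    with False assms show ?thesis by (simp add: mult_nonneg_nonpos)
  qed
  with L_tangent[OF assms \<tau>(1)[of \<xi>]] show ?thesis
    unfolding rate_def by (simp add: algebra_simps)
qed

lemma rate_nonneg: "rate \<xi> \<ge> 0"
  using rate_ge[of 0 \<xi>] T_less_1 by (simp add: L_0 \<theta>\<^sub>0_def)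

lemma good_rate_function_rate: "good_rate_function (\<lambda>x. ereal (rate x))"
proof -
  have "compact {x. ereal (rate x) \<le> ereal c}" for c
  proof -
    \<comment> \<open>\<open>rate\<close> is a supremum of affine functions, attained at
      \<open>\<tau> x\<close>, so its sublevel sets are intersections of closed half-lines.\<close>
    have eq: "{x. ereal (rate x) \<le> ereal c} = (\<Inter>\<theta>\<in>{\<theta>\<^sub>0..}. {x. \<theta> * x - L \<theta> \<le> c})" (is "?A = ?B")
    proof (intro antisym subsetI)
      fix x assume "x \<in> ?A"
      then show "x \<in> ?B" using rate_ge order_trans by fastforce
    next
      fix x assume "x \<in> ?B"
      then show "x \<in> ?A" using \<tau>(1)[of x] by (auto simp: rate_def)
    qed
    have "closed ?B"
      by (intro closed_INT ballI closed_Collect_le continuous_intros)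
    \<comment> \<open>Two tilts of opposite sign suffice for boundedness:
      \<open>\<theta>\<^sub>0 < 0\<close> bounds from below, 1 from above.\<close>
    moreover have "?B \<subseteq> {(c + L \<theta>\<^sub>0) / \<theta>\<^sub>0..c + L 1}"
    proof
      fix x assume x: "x \<in> ?B"
      have "\<theta>\<^sub>0 < 0" using T_less_1 by (simp add: \<theta>\<^sub>0_def)
      moreover from x have "\<theta>\<^sub>0 * x - L \<theta>\<^sub>0 \<le> c" by auto
      moreover from x \<open>\<theta>\<^sub>0 < 0\<close> have "1 * x - L 1 \<le> c" by (auto dest: bspec[of _ _ 1])
      ultimately show "x \<in> {(c + L \<theta>\<^sub>0) / \<theta>\<^sub>0..c + L 1}" by (simp add: field_simps)
    qed
    ultimately have "compact ?B"
      by (meson bounded_closed_interval bounded_subset compact_eq_bounded_closed)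
    with eq show ?thesis by simp
  qed
  then show ?thesis by (simp add: good_rate_function_def rate_nonneg)
qed

text \<open>Prepares the lower bound: \<open>\<theta> * D \<theta> - L \<theta>\<close> is the cost
  of reaching \<open>D \<theta>\<close> by tilting, the last term that of descending to
  \<open>\<xi>\<close>. At \<open>\<tau> \<xi>\<close> the total equals \<open>rate \<xi>\<close>; a
  small move to the right keeps it close and makes both constraints strict.\<close>

lemma rate_approx:
  assumes "\<epsilon> > 0"
  shows "\<exists>\<theta>>\<theta>\<^sub>0. D \<theta> > \<xi> \<and> \<theta> * D \<theta> - L \<theta> + (1 - T) * (D \<theta> - \<xi>) < rate \<xi> + \<epsilon>"
proof -
  let ?g = "\<lambda>\<theta>. \<theta> * D \<theta> - L \<theta> + (1 - T) * (D \<theta> - \<xi>)"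
  have "continuous_on {\<theta>\<^sub>0..} ?g"
    by (intro continuous_intros continuous_on_L continuous_on_D)
  then have "(?g \<longlongrightarrow> ?g (\<tau> \<xi>)) (at (\<tau> \<xi>) within {\<theta>\<^sub>0..})"
    using \<tau>(1) by (auto simp: continuous_on_def)
  then have "(?g \<longlongrightarrow> ?g (\<tau> \<xi>)) (at_right (\<tau> \<xi>))"
    by (rule tendsto_within_subset) (use \<tau>(1)[of \<xi>] in auto)
  moreover have "?g (\<tau> \<xi>) = rate \<xi>"
  proof (cases "\<xi> \<ge> D \<theta>\<^sub>0")
    case True
    then show ?thesis by (simp add: \<tau> rate_def)
  next
    case False
    then have "\<tau> \<xi> = \<theta>\<^sub>0" by (simp add: \<tau>_below)
    \<comment> \<open>The slope \<open>1 - T\<close> is \<open>- \<theta>\<^sub>0\<close>, so the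
      terms with \<open>D \<theta>\<^sub>0\<close> cancel.\<close>
    then show ?thesis by (simp add: rate_def) (simp add: \<theta>\<^sub>0_def algebra_simps)
  qed
  ultimately have "eventually (\<lambda>\<theta>. ?g \<theta> < rate \<xi> + \<epsilon>) (at_right (\<tau> \<xi>))"
    using assms by (intro order_tendstoD(2)) auto
  moreover have "eventually (\<lambda>\<theta>. \<theta> > \<tau> \<xi>) (at_right (\<tau> \<xi>))"
    by (simp add: eventually_at_right_less)
  ultimately have "\<exists>\<theta>. ?g \<theta> < rate \<xi> + \<epsilon> \<and> \<theta> > \<tau> \<xi>"
    by (metis (mono_tags, lifting) eventually_conj eventually_happens' trivial_limit_at_right_real)
  then obtain \<theta> where "?g \<theta> < rate \<xi> + \<epsilon>" "\<theta> > \<tau> \<xi>" by blast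
  moreover from this have "D \<theta> > \<xi>" "\<theta> > \<theta>\<^sub>0"
    using D_strict_mono[of "\<tau> \<xi>" \<theta>] \<tau>[of \<xi>] by auto
  ultimately show ?thesis by blast
qed

end

section \<open>A weak form of Stirling's formula\<close>

text \<open>Every \<open>z \<ge> b\<close> is a natural-number shift of a point of
  \<open>{b..b + 1}\<close>, and shifting does not increase \<open>f\<close>; the maximum on the
  compact interval therefore bounds \<open>f\<close> everywhere.\<close>

lemma bounded_above_on_shifts:
  fixes f :: "real \<Rightarrow> real"
  assumes cont: "continuous_on {b..b + 1} f"
    and step: "\<And>z. z \<ge> b \<Longrightarrow> f (z + 1) \<le> f z"
  shows "\<exists>C. \<forall>z\<ge>b. f z \<le> C"
proof -
  obtain C where C: "f x \<le> C" if "x \<in> {b..b + 1}" for x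
    using continuous_attains_sup[OF _ _ cont] by fastforce
  have "f (x + real n) \<le> C" if "x \<in> {b..b + 1}" for x n
  proof (induction n)
    case (Suc n)
    have "f (x + real n + 1) \<le> f (x + real n)" using that by (intro step) auto
    with Suc show ?case by (simp add: add_ac)
  qed (use that C in auto)
  moreover have "\<exists>x n. z = x + real n \<and> x \<in> {b..b + 1}" if "z \<ge> b" for z
  proof (intro exI conjI)
    show "z = (z - real (nat \<lfloor>z - b\<rfloor>)) + real (nat \<lfloor>z - b\<rfloor>)" by simp
    show "z - real (nat \<lfloor>z - b\<rfloor>) \<in> {b..b + 1}" using that by simp linarith
  qed
  ultimately show ?thesis by metis
qed

lemma ln_Gamma_real_plus1: "z > 0 \<Longrightarrow> ln_Gamma (z + 1) = ln_Gamma z + ln (z :: real)"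
  by (simp add: ln_Gamma_real_pos Gamma_plus1 ln_mult_pos nonpos_Ints_def)

text \<open>Under \<open>z \<mapsto> z + 1\<close> the deviation from Stirling's main term changes by
  \<open>1 - (z + 1) * ln (1 + 1 / z)\<close>, which lies between \<open>- 1 / z\<close> and \<open>0\<close>.\<close>

lemma ln_Gamma_weak_stirling:
  fixes b :: real
  assumes "b > 0"
  shows "\<exists>C. \<forall>z\<ge>b. \<bar>ln_Gamma z - (z * ln z - z)\<bar> \<le> C * (1 + \<bar>ln z\<bar>)"
proof -
  define R where "R z = ln_Gamma z - (z * ln z - z)" for z :: real
  define c where "c = 1 + 1 / b"
  have c: "c > 0" using assms by (simp add: c_def add_pos_pos)
  have R_step: "R (z + 1) = R z + (1 - (z + 1) * (ln (z + 1) - ln z))" if "z \<ge> b" for z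
    using that assms by (subst R_def, subst ln_Gamma_real_plus1) (auto simp: R_def algebra_simps)
  have ln_step: "1 / (z + 1) \<le> ln (z + 1) - ln z" "ln (z + 1) - ln z \<le> 1 / z" if "z \<ge> b" for z
  proof -
    have "z > 0" using that assms by simp
    then show "1 / (z + 1) \<le> ln (z + 1) - ln z"
      using ln_diff_le[of z "z + 1"] by simp
    show "ln (z + 1) - ln z \<le> 1 / z"
      using ln_diff_le[of "z + 1" z] \<open>z > 0\<close> by simp
  qed
  have cont: "continuous_on {b..b + 1} R"
    unfolding R_def using assms
    by (intro continuous_intros DERIV_continuous_on[OF has_field_derivative_at_within[OF has_field_derivative_ln_Gamma_real]]) auto
  have "\<exists>C. \<forall>z\<ge>b. R z \<le> C"
  proof (rule bounded_above_on_shifts[OF cont])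
    fix z assume z: "z \<ge> b"
    then have "(z + 1) * (ln (z + 1) - ln z) \<ge> 1"
      using ln_step(1)[OF z] assms by (simp add: field_simps)
    then show "R (z + 1) \<le> R z" using R_step[OF z] by simp
  qed
  then obtain C1 where C1: "\<And>z. z \<ge> b \<Longrightarrow> R z \<le> C1" by blast
  \<comment> \<open>A unit step raises \<open>- R\<close> by at most \<open>1 / z\<close>. For
    \<open>z \<ge> b\<close> this is at most \<open>c / (z + 1)\<close>, hence at most the increment
    of \<open>c * ln z\<close>; this fixes \<open>c = 1 + 1 / b\<close>.\<close>
  have "\<exists>C. \<forall>z\<ge>b. - R z - c * ln z \<le> C"
  proof (rule bounded_above_on_shifts)
    show "continuous_on {b..b + 1} (\<lambda>z. - R z - c * ln z)"
      using assms by (intro continuous_intros cont) auto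
    fix z assume z: "z \<ge> b"
    then have z0: "z > 0" using assms by simp
    have "(z + 1) * (ln (z + 1) - ln z) \<le> (z + 1) * (1 / z)"
      using ln_step(2)[OF z] z0 by (intro mult_left_mono) auto
    moreover have "(z + 1) / z - 1 = 1 / z" using z0 by (simp add: field_simps)
    moreover have "1 / z \<le> c * (1 / (z + 1))"
    proof -
      have "(z + 1) / z \<le> c" using z z0 assms by (simp add: c_def add_divide_distrib frac_le)
      then show ?thesis using z0 by (simp add: field_simps)
    qed
    moreover have "c * (1 / (z + 1)) \<le> c * (ln (z + 1) - ln z)"
      using ln_step(1)[OF z] c by (intro mult_left_mono) auto
    ultimately show "- R (z + 1) - c * ln (z + 1) \<le> - R z - c * ln z"
      using R_step[OF z] by (simp add: algebra_simps)
  qed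
  then obtain C2 where C2: "\<And>z. z \<ge> b \<Longrightarrow> - R z - c * ln z \<le> C2" by blast
  define C where "C = \<bar>C1\<bar> + \<bar>C2\<bar> + c"
  have "\<bar>R z\<bar> \<le> C * (1 + \<bar>ln z\<bar>)" if "z \<ge> b" for z
  proof -
    have "c * ln z \<le> c * \<bar>ln z\<bar>" using c by (intro mult_left_mono) auto
    then have "\<bar>R z\<bar> \<le> \<bar>C1\<bar> + \<bar>C2\<bar> + c * \<bar>ln z\<bar>"
      using C1[OF that] C2[OF that] c mult_nonneg_nonneg[of c "\<bar>ln z\<bar>"] by linarith
    also have "\<dots> \<le> C * (1 + \<bar>ln z\<bar>)"
      using c by (simp add: C_def algebra_simps add_nonneg_nonneg)
    finally show ?thesis .
  qed
  then show ?thesis unfolding R_def by blast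
qed

section \<open>Asymptotics of the moment generating function\<close>

text \<open>The increments of \<open>g\<close> over the cells telescope, and the mean value theorem
  compares each with \<open>f\<close> at the right end of its cell. The derivative is required only
  inside the interval because \<open>a - T\<close> is 0 when the lemma is applied at
  \<open>\<theta>\<^sub>0\<close>.\<close>

lemma riemann_sum_tendsto:
  fixes f g :: "real \<Rightarrow> real" and m :: "nat \<Rightarrow> nat"
  assumes f: "continuous_on {a - T..a} f" and g: "continuous_on {a - T..a} g"
    and deriv: "\<And>x. a - T < x \<Longrightarrow> x < a \<Longrightarrow> (g has_real_derivative f x) (at x)"
    and m_le: "\<And>n. real (m n) \<le> real n * T"
    and m_lim: "(\<lambda>n. real (m n) / real n) \<longlonglongrightarrow> T"
  shows "(\<lambda>n. (\<Sum>k<m n. f (a - real k / real n)) / real n) \<longlonglongrightarrow> g a - g (a - T)"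
proof -
  define S where "S n = (\<Sum>k<m n. f (a - real k / real n)) / real n" for n
  define p where "p n k = a - real k / real n" for n k :: nat
  have p_in: "p n k \<in> {a - T..a}" if "n > 0" "k \<le> m n" for n k
  proof -
    have "real k \<le> real n * T" using m_le[of n] that(2) by linarith
    then show ?thesis using that(1) by (simp add: p_def field_simps)
  qed
  have p_step: "p n k - p n (Suc k) = 1 / real n" for n k
    by (simp add: p_def add_divide_distrib)
  have "(\<lambda>n. p n (m n)) \<longlonglongrightarrow> a - T"
    unfolding p_def by (intro tendsto_intros m_lim)
  moreover have "a - T \<in> {a - T..a}"
  proof -
    have "T \<ge> 0" using LIMSEQ_le_const[OF m_lim, of 0] by simp
    then show ?thesis by simp
  qed
  moreover have "eventually (\<lambda>n. p n (m n) \<in> {a - T..a}) sequentially"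
    using eventually_gt_at_top[of 0] by eventually_elim (simp add: p_in del: atLeastAtMost_iff)
  ultimately have "(\<lambda>n. g (p n (m n))) \<longlonglongrightarrow> g (a - T)"
    using g continuous_on_tendsto_compose by blast
  then have lim: "(\<lambda>n. g a - g (p n (m n))) \<longlonglongrightarrow> g a - g (a - T)"
    by (intro tendsto_intros)
  have "(\<lambda>n. S n - (g a - g (p n (m n)))) \<longlonglongrightarrow> 0"
  proof (rule tendstoI)
    fix e :: real assume "e > 0"
    \<comment> \<open>At most \<open>n * T\<close> cells contribute an error \<open>e' / n\<close>
      each; the added 1 gives a strict inequality and covers \<open>T = 0\<close>.\<close>
    define e' where "e' = e / (T + 1)"
    have T0: "T \<ge> 0" using LIMSEQ_le_const[OF m_lim, of 0] by simp
    have e': "e' > 0" using \<open>e > 0\<close> T0 by (simp add: e'_def)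
    have "uniformly_continuous_on {a - T..a} f"
      using f by (simp add: compact_uniformly_continuous)
    then obtain d where d: "d > 0"
      "\<And>x y. x \<in> {a - T..a} \<Longrightarrow> y \<in> {a - T..a} \<Longrightarrow> dist y x < d \<Longrightarrow> dist (f y) (f x) < e'"
      using e' unfolding uniformly_continuous_on_def by metis
    have "eventually (\<lambda>n. 1 / real n < d) sequentially"
      using order_tendstoD(2)[OF lim_1_over_n \<open>d > 0\<close>] by simp
    then show "eventually (\<lambda>n. dist (S n - (g a - g (p n (m n)))) 0 < e) sequentially"
      using eventually_gt_at_top[of 0]
    proof eventually_elim
      case (elim n)
      have "\<bar>f (p n k) / n - (g (p n k) - g (p n (Suc k)))\<bar> \<le> e' / n" if "k < m n" for k
      proof -
        have in1: "p n k \<in> {a - T..a}" and in2: "p n (Suc k) \<in> {a - T..a}"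
          using p_in elim that by simp_all
        have less: "p n (Suc k) < p n k" using p_step[of n k] elim
          by (simp add: p_def field_simps)
        have "\<exists>l z. p n (Suc k) < z \<and> z < p n k \<and> DERIV g z :> l \<and>
          g (p n k) - g (p n (Suc k)) = (p n k - p n (Suc k)) * l"
          using less in1 in2
          by (intro MVT continuous_on_subset[OF g])
            (auto simp: real_differentiable_def intro!: exI deriv)
        then obtain l z where z: "p n (Suc k) < z" "z < p n k" "DERIV g z :> l"
          "g (p n k) - g (p n (Suc k)) = (p n k - p n (Suc k)) * l" by blast
        have "l = f z" using z in1 in2 by (intro DERIV_unique[OF _ deriv]) auto
        have "dist (f z) (f (p n k)) < e'"
          using z in1 in2 elim p_step[of n k] by (intro d) (auto simp: dist_real_def)
        then have "\<bar>f (p n k) - f z\<bar> / n \<le> e' / n"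
          using elim by (intro divide_right_mono) (auto simp: dist_real_def)
        moreover have "f (p n k) / n - (g (p n k) - g (p n (Suc k))) = (f (p n k) - f z) / n"
          using z(4) p_step[of n k] \<open>l = f z\<close> by (simp add: diff_divide_distrib)
        ultimately show ?thesis by (simp add: abs_divide)
      qed
      then have "\<bar>\<Sum>k<m n. f (p n k) / n - (g (p n k) - g (p n (Suc k)))\<bar> \<le> (\<Sum>k<m n. e' / n)"
        by (intro order_trans[OF sum_abs] sum_mono) auto
      also have "(\<Sum>k<m n. f (p n k) / n - (g (p n k) - g (p n (Suc k)))) = S n - (g a - g (p n (m n)))"
        by (subst sum_subtractf, subst sum_lessThan_telescope') (simp add: S_def p_def sum_divide_distrib)
      also have "(\<Sum>k<m n. e' / n) = e' * (m n / n)" by simp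
      also have "\<dots> \<le> e' * T"
        using e' m_le[of n] elim by (intro mult_left_mono) (auto simp: field_simps)
      also have "\<dots> < e" using \<open>e > 0\<close> T0 by (simp add: e'_def field_simps)
      finally show ?case by simp
    qed
  qed
  from tendsto_add[OF this lim] show ?thesis by (simp add: S_def)
qed

text \<open>The logarithm of the moment generating function at \<open>b * n\<^sup>2 * \<theta>\<close>
  of the average of \<open>m\<close> log-gamma variables with shapes \<open>b * n, b * (n - 1), \<dots>\<close>.\<close>

definition log_mgf :: "real \<Rightarrow> nat \<Rightarrow> nat \<Rightarrow> real \<Rightarrow> real" where
  "log_mgf b m n \<theta> = (\<Sum>k<m. ln_Gamma (b * n * (1 + \<theta> - real k / n)) -
     ln_Gamma (b * n * (1 - real k / n)) - b * n * \<theta> * ln (b * n))"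

context window
begin

text \<open>At \<open>z = b * n * y\<close> the main term \<open>z * ln z - z\<close> equals
  \<open>b * n * (y * ln y - y)\<close> plus \<open>b * n * y * ln (b * n)\<close>. In the
  difference of the two gamma terms the latter cancels against
  \<open>b * n * \<theta> * ln (b * n)\<close>, leaving a difference of two Riemann sums of
  \<open>J_fun\<close>.\<close>

lemma log_mgf_tendsto:
  assumes b: "b > 0" and \<theta>: "\<theta> \<ge> \<theta>\<^sub>0"
    and m_le: "\<And>n. real (m n) \<le> real n * T"
    and m_lim: "(\<lambda>n. real (m n) / real n) \<longlonglongrightarrow> T"
  shows "(\<lambda>n. log_mgf b (m n) n \<theta> / (b * (real n)\<^sup>2)) \<longlonglongrightarrow> L \<theta>"
proof -
  define R where "R z = ln_Gamma z - (z * ln z - z)" for z :: real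
  obtain C where C: "\<And>z. z \<ge> b \<Longrightarrow> \<bar>R z\<bar> \<le> C * (1 + \<bar>ln z\<bar>)"
    using ln_Gamma_weak_stirling[OF b] unfolding R_def by blast
  have "0 \<le> C * (1 + \<bar>ln b\<bar>)" using C[of b] by linarith
  then have C0: "C \<ge> 0" by (auto simp: zero_le_mult_iff)
  define S where "S t n = (\<Sum>k<m n. J_fun (1 + t - real k / n)) / n" for t n
  have S: "S t \<longlonglongrightarrow> F_fun (1 + t) - F_fun (1 + t - T)" if "t \<ge> \<theta>\<^sub>0" for t
    unfolding S_def using that
    by (intro riemann_sum_tendsto m_le m_lim continuous_on_subset[OF continuous_on_J_fun]
        continuous_on_subset[OF continuous_on_F_fun] F_fun_has_derivative) (auto simp: \<theta>\<^sub>0_def)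
  have "\<theta>\<^sub>0 \<le> 0" using T_less_1 by (simp add: \<theta>\<^sub>0_def)
  define K where "K = 1 + 2 * \<bar>ln b\<bar> + ln (1 + \<bar>\<theta>\<bar>)"
  have R_bound: "\<bar>R (b * n * (1 + t - real k / n))\<bar> \<le> C * (K + ln n)"
    if n: "n > 0" and k: "k < m n" and t: "t \<ge> \<theta>\<^sub>0" "t \<le> \<bar>\<theta>\<bar>" for n k t
  proof -
    define z where "z = b * n * (1 + t - real k / n)"
    have z_eq: "z = b * (n * (1 + t) - k)" using n by (simp add: z_def field_simps)
    \<comment> \<open>The off-by-one matters: \<open>k < m n\<close> leaves room for one unit, so
      the argument is at least \<open>b\<close> even at \<open>t = \<theta>\<^sub>0\<close>, and the
      weak Stirling bound applies.\<close>
    have "real k + 1 \<le> real n * T" using m_le[of n] k by linarith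
    moreover have "real n * T \<le> real n * (1 + t)"
      using t by (intro mult_left_mono) (auto simp: \<theta>\<^sub>0_def)
    ultimately have "b * 1 \<le> z" unfolding z_eq using b by (intro mult_left_mono) auto
    then have zb: "z \<ge> b" by simp
    have "n * (1 + t) \<le> n * (1 + \<bar>\<theta>\<bar>)" using t by (intro mult_left_mono) auto
    then have "z \<le> b * (n * (1 + \<bar>\<theta>\<bar>))"
      unfolding z_eq using b by (intro mult_left_mono) linarith+
    then have "ln z \<le> ln (b * (n * (1 + \<bar>\<theta>\<bar>)))" using zb b n by (intro ln_mono) auto
    also have "\<dots> = ln b + (ln n + ln (1 + \<bar>\<theta>\<bar>))" using b n by (simp add: ln_mult_pos)
    finally have 1: "ln z \<le> ln b + (ln n + ln (1 + \<bar>\<theta>\<bar>))" .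
    have 2: "ln b \<le> ln z" using zb b by (intro ln_mono) auto
    have "ln n \<ge> 0" "ln (1 + \<bar>\<theta>\<bar>) \<ge> 0" using n by auto
    with 1 2 have "1 + \<bar>ln z\<bar> \<le> K + ln n" unfolding K_def by linarith
    then have "C * (1 + \<bar>ln z\<bar>) \<le> C * (K + ln n)" using C0 by (rule mult_left_mono)
    with C[OF zb] show ?thesis unfolding z_def by linarith
  qed
  have ev: "eventually (\<lambda>n. norm (log_mgf b (m n) n \<theta> / (b * (real n)\<^sup>2) - (S \<theta> n - S 0 n))
      \<le> 2 * C / b * ((K + ln n) / n)) sequentially"
    using eventually_gt_at_top[of 0]
  proof eventually_elim
    case (elim n)
    have y_pos: "1 + t - real k / n > 0" if "k < m n" "t \<ge> \<theta>\<^sub>0" for k t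
    proof -
      have "real k < real n * T" using m_le[of n] that by linarith
      then have "real k / n < T" using elim by (simp add: field_simps)
      with that(2) show ?thesis by (simp add: \<theta>\<^sub>0_def)
    qed
    have "log_mgf b (m n) n \<theta> = (\<Sum>k<m n.
        (R (b * n * (1 + \<theta> - real k / n)) - R (b * n * (1 + 0 - real k / n))) +
        b * n * (J_fun (1 + \<theta> - real k / n) - J_fun (1 + 0 - real k / n)))"
      unfolding log_mgf_def
    proof (intro sum.cong refl)
      fix k assume "k \<in> {..<m n}"
      define y where "y = 1 + \<theta> - real k / n"
      define y' where "y' = 1 + 0 - real k / n"
      have "y > 0" "y' > 0" using y_pos[of k \<theta>] y_pos[of k 0] \<open>k \<in> {..<m n}\<close> \<theta> \<open>\<theta>\<^sub>0 \<le> 0\<close> by (auto simp: y_def y'_def)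
      moreover have bn: "b * n > 0" using b elim by simp
      ultimately have ln: "ln (b * n * y) = ln (b * n) + ln y" "ln (b * n * y') = ln (b * n) + ln y'"
        by (simp_all only: ln_mult_pos)
      have \<theta>_eq: "\<theta> = y - y'" by (simp add: y_def y'_def)
      show "ln_Gamma (b * n * (1 + \<theta> - real k / n)) - ln_Gamma (b * n * (1 - real k / n)) -
          b * n * \<theta> * ln (b * n) =
        R (b * n * (1 + \<theta> - real k / n)) - R (b * n * (1 + 0 - real k / n)) +
        b * n * (J_fun (1 + \<theta> - real k / n) - J_fun (1 + 0 - real k / n))"
        unfolding y_def[symmetric] y'_def[symmetric] R_def J_fun_eq ln
        by (simp add: \<theta>_eq y'_def[simplified, symmetric] algebra_simps)
    qed
    also have "\<dots> = (\<Sum>k<m n. R (b * n * (1 + \<theta> - real k / n)) - R (b * n * (1 + 0 - real k / n))) +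
        b * n * (n * S \<theta> n - n * S 0 n)" (is "_ = ?E + _")
    proof -
      have "n * S t n = (\<Sum>k<m n. J_fun (1 + t - real k / n))" for t
        using elim by (simp add: S_def)
      then show ?thesis
        by (simp add: sum.distrib sum_subtractf sum_distrib_left right_diff_distrib)
    qed
    also have "b * n * (n * S \<theta> n - n * S 0 n) = b * n\<^sup>2 * (S \<theta> n - S 0 n)"
      by (simp add: power2_eq_square algebra_simps)
    finally have "log_mgf b (m n) n \<theta> / (b * (real n)\<^sup>2) - (S \<theta> n - S 0 n) = ?E / (b * n\<^sup>2)"
      using b elim by (simp add: add_divide_distrib)
    also have "norm \<dots> \<le> (\<Sum>k<m n. 2 * (C * (K + ln n))) / (b * n\<^sup>2)"
    proof -
      have "\<bar>?E\<bar> \<le> (\<Sum>k<m n. 2 * (C * (K + ln n)))"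
      proof (intro order_trans[OF sum_abs] sum_mono)
        fix k assume "k \<in> {..<m n}"
        then show "\<bar>R (b * n * (1 + \<theta> - real k / n)) - R (b * n * (1 + 0 - real k / n))\<bar>
            \<le> 2 * (C * (K + ln n))"
          using R_bound[of n k \<theta>] R_bound[of n k 0] elim \<theta> \<open>\<theta>\<^sub>0 \<le> 0\<close> abs_ge_self[of \<theta>]
          by simp
      qed
      then show ?thesis using b by (simp add: divide_right_mono abs_divide abs_mult)
    qed
    \<comment> \<open>At most \<open>n\<close> errors of logarithmic size, to be divided by
      \<open>b * n\<^sup>2\<close>.\<close>
    also have "(\<Sum>k<m n. 2 * (C * (K + ln n))) \<le> n * (2 * (C * (K + ln n)))"
    proof -
      have "K + ln n \<ge> 0" using elim unfolding K_def by (intro add_nonneg_nonneg) auto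
      moreover have "real (m n) \<le> real n"
        using m_le[of n] T_less_1 mult_left_mono[of T 1 "real n"] by simp
      ultimately show ?thesis using C0 by (simp add: mult_right_mono)
    qed
    also have "n * (2 * (C * (K + ln n))) / (b * n\<^sup>2) = 2 * C / b * ((K + ln n) / n)"
      using elim b by (simp add: power2_eq_square)
    finally show ?case using b by (simp add: divide_right_mono)
  qed
  have "(\<lambda>n. (K + ln (real n)) / real n) \<longlonglongrightarrow> 0" by real_asymp
  then have "(\<lambda>n. 2 * C / b * ((K + ln n) / n)) \<longlonglongrightarrow> 0"
    by (rule tendsto_mult_right_zero)
  with ev have "(\<lambda>n. log_mgf b (m n) n \<theta> / (b * (real n)\<^sup>2) - (S \<theta> n - S 0 n)) \<longlonglongrightarrow> 0"
    by (rule Lim_null_comparison)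
  from tendsto_add[OF this tendsto_diff[OF S[OF \<theta>] S[OF \<open>\<theta>\<^sub>0 \<le> 0\<close>]]] show ?thesis
    by (simp add: L_def algebra_simps)
qed

end

text \<open>Substituting \<open>2 * x\<close> turns the integral into Euler's integral for
  \<open>Gamma (\<kappa> + l)\<close>. The condition \<open>\<kappa> + l > 0\<close> is that of
  convergence at 0 and is the source of \<open>\<theta>\<^sub>0\<close>.\<close>

lemma gamma_density_log_mgf:
  fixes X :: "'a \<Rightarrow> real"
  assumes X: "distributed M lborel X (gamma_density \<kappa> (1 / 2))"
    and \<kappa>: "\<kappa> > 0" and s: "\<kappa> + l > 0" and c: "c > 0"
  shows "(\<integral>\<^sup>+\<omega>. ennreal (exp (l * ln (X \<omega> / c))) \<partial>M) =
    ennreal (exp (ln_Gamma (\<kappa> + l) - ln_Gamma \<kappa> - l * ln (c / 2)))"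
proof -
  let ?f = "\<lambda>x. gamma_density \<kappa> (1 / 2) x * ennreal (exp (l * ln (x / c)))"
  define K where "K = exp (- ln_Gamma \<kappa> - l * ln (c / 2))"
  have [measurable]: "gamma_density \<kappa> (1 / 2) \<in> borel_measurable borel"
    using X by (simp add: distributed_def)
  have "(\<integral>\<^sup>+\<omega>. ennreal (exp (l * ln (X \<omega> / c))) \<partial>M) = (\<integral>\<^sup>+x. ?f x \<partial>lborel)"
    by (rule distributed_nn_integral[OF X, symmetric]) measurable
  also have "\<dots> = 2 * (\<integral>\<^sup>+x. ?f (0 + 2 * x) \<partial>lborel)"
    by (subst nn_integral_real_affine[of _ 2 0]) (auto simp: ennreal_numeral[symmetric] simp del: ennreal_numeral)
  also have "\<dots> = (\<integral>\<^sup>+x. 2 * ?f (0 + 2 * x) \<partial>lborel)"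
    by (rule nn_integral_cmult[symmetric]) measurable
  also have "\<dots> = (\<integral>\<^sup>+x. ennreal K * ennreal (indicator {0..} x * x powr (\<kappa> + l - 1) / exp x) \<partial>lborel)"
  proof (intro nn_integral_cong)
    fix x :: real
    consider "x < 0" | "x = 0" | "x > 0" by linarith
    then show "2 * ?f (0 + 2 * x) = ennreal K * ennreal (indicator {0..} x * x powr (\<kappa> + l - 1) / exp x)"
    proof cases
      case 3
      have "2 * ((1 / 2) powr \<kappa> * (2 * x) powr (\<kappa> - 1) * exp (- (1 / 2) * (2 * x)) / Gamma \<kappa>
          * exp (l * ln (2 * x / c))) = K * (x powr (\<kappa> + l - 1) / exp x)"
      proof -
        have "2 * ((1 / 2) powr \<kappa> * (2 * x) powr (\<kappa> - 1) * exp (- (1 / 2) * (2 * x)) / Gamma \<kappa>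
          * exp (l * ln (2 * x / c))) =
          exp (ln 2 + (\<kappa> * ln (1 / 2) + (\<kappa> - 1) * ln (2 * x) + (- x) - ln_Gamma \<kappa> + l * ln (2 * x / c)))"
          using 3 \<kappa> by (simp add: exp_add exp_diff exp_minus powr_def Gamma_real_pos_exp field_simps)
        also have "\<dots> = exp (- ln_Gamma \<kappa> - l * ln (c / 2) + (\<kappa> + l - 1) * ln x - x)"
          using 3 c by (intro arg_cong[of _ _ exp]) (simp add: ln_div ln_mult_pos algebra_simps)
        also have "\<dots> = K * (x powr (\<kappa> + l - 1) / exp x)"
          using 3 by (simp add: K_def exp_add exp_diff powr_def)
        finally show ?thesis .
      qed
      moreover have "K \<ge> 0" by (simp add: K_def)
      ultimately show ?thesis
        using 3 \<kappa> by (simp add: gamma_density_def ennreal_mult'[symmetric] ennreal_numeral[symmetric]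
            del: ennreal_numeral)
    qed (auto simp: gamma_density_def)
  qed
  also have "\<dots> = ennreal K * ennreal (Gamma (\<kappa> + l))"
    using s by (subst nn_integral_cmult) (simp_all add: Gamma_conv_nn_integral_real)
  also have "\<dots> = ennreal (K * Gamma (\<kappa> + l))"
    by (rule ennreal_mult'[symmetric]) (simp add: K_def)
  also have "K * Gamma (\<kappa> + l) = exp (ln_Gamma (\<kappa> + l) - ln_Gamma \<kappa> - l * ln (c / 2))"
    using s by (simp add: K_def Gamma_real_pos_exp exp_add[symmetric] exp_diff)
  finally show ?thesis .
qed

text \<open>Nonnegative integrals factor by independence, and finiteness of the product yields
  integrability. Hypothesis \<open>pos\<close> says that the smallest shape
  \<open>b * (n - m + 1)\<close> stays positive after adding the tilt
  \<open>b * n * \<theta>\<close>.\<close>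

lemma (in prob_space) gamma_sum_log_mgf:
  fixes X :: "nat \<Rightarrow> 'a \<Rightarrow> real"
  assumes indep: "indep_vars (\<lambda>_. borel) X {1..n}"
    and gamma: "\<And>k. 1 \<le> k \<Longrightarrow> k \<le> n \<Longrightarrow>
      distributed M lborel (X k) (gamma_density (b * real (n - k + 1)) (1 / 2))"
    and b: "b > 0" and n: "n > 0" and "m \<le> n" and pos: "n * (1 + \<theta>) > real m - 1"
  shows "has_bochner_integral M
    (\<lambda>\<omega>. exp (b * n * \<theta> * (\<Sum>k=1..m. ln (X k \<omega> / (2 * b * n))))) (exp (log_mgf b m n \<theta>))"
proof (rule has_bochner_integral_nn_integral)
  have X: "random_variable borel (X k)" if "k \<in> {1..m}" for k
    using indep that \<open>m \<le> n\<close> by (auto simp: indep_vars_def)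
  then show "(\<lambda>\<omega>. exp (b * n * \<theta> * (\<Sum>k=1..m. ln (X k \<omega> / (2 * b * n))))) \<in> borel_measurable M"
    by (intro measurable_compose[OF _ borel_measurable_exp] borel_measurable_times borel_measurable_sum
        borel_measurable_const borel_measurable_ln borel_measurable_divide) auto
  have "indep_vars (\<lambda>_. borel) (\<lambda>k \<omega>. ennreal (exp (b * n * \<theta> * ln (X k \<omega> / (2 * b * n))))) {1..m}"
    by (rule indep_vars_compose2[OF indep_vars_subset[OF indep]]) (use \<open>m \<le> n\<close> in auto)
  then have "(\<integral>\<^sup>+\<omega>. (\<Prod>k\<in>{1..m}. ennreal (exp (b * n * \<theta> * ln (X k \<omega> / (2 * b * n))))) \<partial>M) =
      (\<Prod>k\<in>{1..m}. \<integral>\<^sup>+\<omega>. ennreal (exp (b * n * \<theta> * ln (X k \<omega> / (2 * b * n)))) \<partial>M)"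
    by (intro indep_vars_nn_integral) auto
  also have "(\<lambda>\<omega>. \<Prod>k\<in>{1..m}. ennreal (exp (b * n * \<theta> * ln (X k \<omega> / (2 * b * n))))) =
      (\<lambda>\<omega>. ennreal (exp (b * n * \<theta> * (\<Sum>k=1..m. ln (X k \<omega> / (2 * b * n))))))"
    by (simp add: prod_ennreal exp_sum sum_distrib_left)
  also have "(\<Prod>k\<in>{1..m}. \<integral>\<^sup>+\<omega>. ennreal (exp (b * n * \<theta> * ln (X k \<omega> / (2 * b * n)))) \<partial>M) =
      (\<Prod>k\<in>{1..m}. ennreal (exp (ln_Gamma (b * real (n - k + 1) + b * n * \<theta>) -
        ln_Gamma (b * real (n - k + 1)) - b * n * \<theta> * ln (2 * b * n / 2))))"
  proof (intro prod.cong refl gamma_density_log_mgf gamma)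
    fix k assume k: "k \<in> {1..m}"
    have "b * (real (n - k + 1) + n * \<theta>) > 0"
      using k pos b \<open>m \<le> n\<close> by (intro mult_pos_pos) (auto simp: of_nat_diff algebra_simps)
    then show "b * real (n - k + 1) + b * n * \<theta> > 0" by (simp add: algebra_simps)
    show "b * real (n - k + 1) > 0" using b by simp
  qed (use \<open>m \<le> n\<close> b n in auto)
  also have "\<dots> = ennreal (exp (\<Sum>k\<in>{1..m}. ln_Gamma (b * real (n - k + 1) + b * n * \<theta>) -
        ln_Gamma (b * real (n - k + 1)) - b * n * \<theta> * ln (b * n)))"
    by (simp add: prod_ennreal exp_sum)
  also have "(\<Sum>k\<in>{1..m}. ln_Gamma (b * real (n - k + 1) + b * n * \<theta>) -
        ln_Gamma (b * real (n - k + 1)) - b * n * \<theta> * ln (b * n)) = log_mgf b m n \<theta>"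
    unfolding log_mgf_def
  proof (rule sum.reindex_bij_witness[of _ Suc "\<lambda>k. k - 1"])
    fix k assume "k \<in> {1..m}"
    then have eq: "real (n - k + 1) = n * (1 - real (k - 1) / n)"
      using n \<open>m \<le> n\<close> by (simp add: of_nat_diff field_simps)
    moreover have "b * real (n - k + 1) + b * n * \<theta> = b * n * (1 + \<theta> - real (k - 1) / n)"
      unfolding eq by (simp only: algebra_simps)
    ultimately show "ln_Gamma (b * n * (1 + \<theta> - real (k - 1) / n)) -
        ln_Gamma (b * n * (1 - real (k - 1) / n)) - b * n * \<theta> * ln (b * n) =
      ln_Gamma (b * real (n - k + 1) + b * n * \<theta>) -
        ln_Gamma (b * real (n - k + 1)) - b * n * \<theta> * ln (b * n)"
      by (simp add: mult.assoc)
  qed auto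
  finally show "(\<integral>\<^sup>+\<omega>. ennreal (exp (b * n * \<theta> * (\<Sum>k=1..m. ln (X k \<omega> / (2 * b * n))))) \<partial>M) =
      ennreal (exp (log_mgf b m n \<theta>))" .
qed auto

section \<open>Chernoff bounds\<close>

lemma limsup_ereal_ln_le:
  fixes a p :: "nat \<Rightarrow> real"
  assumes a: "filterlim a at_top sequentially"
    and bound: "\<And>\<epsilon>. \<epsilon> > 0 \<Longrightarrow> eventually (\<lambda>n. p n \<le> exp (- (a n * (r - \<epsilon>)))) sequentially"
  shows "limsup (\<lambda>n. ereal_ln (p n) * ereal (1 / a n)) \<le> - ereal r"
proof (rule ereal_le_epsilon2)
  fix \<epsilon> :: real assume "\<epsilon> > 0"
  have "eventually (\<lambda>n. a n > 0) sequentially"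
    using a by (simp add: filterlim_at_top_dense)
  with bound[OF \<open>\<epsilon> > 0\<close>]
  have "eventually (\<lambda>n. ereal_ln (p n) * ereal (1 / a n) \<le> - ereal r + ereal \<epsilon>) sequentially"
  proof eventually_elim
    case (elim n)
    show ?case
    proof (cases "p n > 0")
      case True
      with elim have "ln (p n) \<le> - (a n * (r - \<epsilon>))"
        by (metis exp_gt_zero ln_exp ln_mono)
      with elim have "ln (p n) / a n \<le> - r + \<epsilon>" by (simp add: field_simps)
      with True show ?thesis by (simp add: ereal_ln_def)
    qed (use elim in \<open>simp add: ereal_ln_def\<close>)
  qed
  then show "limsup (\<lambda>n. ereal_ln (p n) * ereal (1 / a n)) \<le> - ereal r + ereal \<epsilon>"
    by (rule Limsup_bounded)
qed

lemma le_liminf_ereal_ln: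
  fixes a p :: "nat \<Rightarrow> real"
  assumes a: "filterlim a at_top sequentially"
    and bound: "\<And>\<epsilon>. \<epsilon> > 0 \<Longrightarrow> eventually (\<lambda>n. p n \<ge> exp (- (a n * (r + \<epsilon>)))) sequentially"
  shows "- ereal r \<le> liminf (\<lambda>n. ereal_ln (p n) * ereal (1 / a n))"
proof (rule ereal_le_epsilon2)
  fix \<epsilon> :: real assume "\<epsilon> > 0"
  have "eventually (\<lambda>n. a n > 0) sequentially"
    using a by (simp add: filterlim_at_top_dense)
  with bound[OF \<open>\<epsilon> > 0\<close>]
  have "eventually (\<lambda>n. - ereal (r + \<epsilon>) \<le> ereal_ln (p n) * ereal (1 / a n)) sequentially"
  proof eventually_elim
    case (elim n)
    then have "p n > 0" by (meson exp_gt_zero less_le_trans)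
    with elim have "- (a n * (r + \<epsilon>)) \<le> ln (p n)"
      by (simp add: ln_ge_iff)
    with elim have "- (r + \<epsilon>) \<le> ln (p n) / a n" by (simp add: field_simps)
    with \<open>p n > 0\<close> show ?case by (simp add: ereal_ln_def)
  qed
  then have "- ereal (r + \<epsilon>) \<le> liminf (\<lambda>n. ereal_ln (p n) * ereal (1 / a n))"
    by (rule Liminf_bounded)
  then have "- ereal (r + \<epsilon>) + ereal \<epsilon> \<le> liminf (\<lambda>n. ereal_ln (p n) * ereal (1 / a n)) + ereal \<epsilon>"
    by (rule add_right_mono)
  then show "- ereal r \<le> liminf (\<lambda>n. ereal_ln (p n) * ereal (1 / a n)) + ereal \<epsilon>"
    by simp
qed

text \<open>The Gaertner-Ellis hypothesis at a single tilt. \<open>has_bochner_integral\<close>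
  records integrability together with the value, and both are required only for large
  \<open>n\<close>.\<close>

definition (in prob_space) mgf_limit ::
    "(nat \<Rightarrow> real) \<Rightarrow> (nat \<Rightarrow> 'a \<Rightarrow> real) \<Rightarrow> real \<Rightarrow> real \<Rightarrow> bool" where
  "mgf_limit a Y \<theta> l \<longleftrightarrow> (\<exists>\<Lambda>. (\<lambda>n. \<Lambda> n / a n) \<longlonglongrightarrow> l \<and>
     eventually (\<lambda>n. has_bochner_integral M (\<lambda>\<omega>. exp (a n * \<theta> * Y n \<omega>)) (exp (\<Lambda> n))) sequentially)"

context prob_space
begin

lemma mgf_limit_bounds:
  assumes "mgf_limit a Y \<theta> l" and a: "filterlim a at_top sequentially" and "\<epsilon> > 0"
  shows "eventually (\<lambda>n. integrable M (\<lambda>\<omega>. exp (a n * \<theta> * Y n \<omega>)) \<and>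
    exp (a n * (l - \<epsilon>)) \<le> expectation (\<lambda>\<omega>. exp (a n * \<theta> * Y n \<omega>)) \<and>
    expectation (\<lambda>\<omega>. exp (a n * \<theta> * Y n \<omega>)) \<le> exp (a n * (l + \<epsilon>))) sequentially"
proof -
  obtain \<Lambda> where lim: "(\<lambda>n. \<Lambda> n / a n) \<longlonglongrightarrow> l" and
    mgf: "eventually (\<lambda>n. has_bochner_integral M (\<lambda>\<omega>. exp (a n * \<theta> * Y n \<omega>)) (exp (\<Lambda> n))) sequentially"
    using assms(1) unfolding mgf_limit_def by blast
  have "eventually (\<lambda>n. a n > 0) sequentially"
    using a by (simp add: filterlim_at_top_dense)
  with mgf tendstoD[OF lim \<open>\<epsilon> > 0\<close>] show ?thesis
  proof eventually_elim
    case (elim n)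
    then have "a n * (l - \<epsilon>) \<le> \<Lambda> n" "\<Lambda> n \<le> a n * (l + \<epsilon>)"
      by (auto simp: dist_real_def abs_less_iff field_simps)
    with elim(1) show ?case by (simp add: has_bochner_integral_iff)
  qed
qed

text \<open>Writing the event as \<open>\<theta> * Y n \<omega> \<ge> r\<close> treats both tails at
  once: the sign of \<open>\<theta>\<close> decides which one is meant.\<close>

lemma eventually_tail_le:
  assumes Y: "\<And>n. random_variable borel (Y n)"
    and mgf: "mgf_limit a Y \<theta> l" and a: "filterlim a at_top sequentially" and "\<epsilon> > 0"
  shows "eventually (\<lambda>n. prob {\<omega> \<in> space M. \<theta> * Y n \<omega> \<ge> r} \<le> exp (- (a n * (r - l - \<epsilon>)))) sequentially"
proof -
  have "eventually (\<lambda>n. a n > 0) sequentially"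
    using a by (simp add: filterlim_at_top_dense)
  with mgf_limit_bounds[OF mgf a \<open>\<epsilon> > 0\<close>] show ?thesis
  proof eventually_elim
    case (elim n)
    have "{\<omega> \<in> space M. \<theta> * Y n \<omega> \<ge> r} = {\<omega> \<in> space M. exp (a n * \<theta> * Y n \<omega>) \<ge> exp (a n * r)}"
      using elim by (auto simp: mult.assoc)
    also have "prob \<dots> \<le> expectation (\<lambda>\<omega>. exp (a n * \<theta> * Y n \<omega>)) / exp (a n * r)"
      using elim by (intro integral_Markov_inequality_measure[where A = "{}"]) auto
    also have "\<dots> \<le> exp (a n * (l + \<epsilon>)) / exp (a n * r)"
      using elim by (intro divide_right_mono) auto
    also have "\<dots> = exp (- (a n * (r - l - \<epsilon>)))"
      by (simp add: exp_diff[symmetric] algebra_simps)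
    finally show ?case .
  qed
qed

text \<open>The lower bound needs no change of measure: splitting \<open>exp (a * \<theta> * Y)\<close> according to whether
  \<open>Y\<close> lies near \<open>\<xi>\<close>, the two tails are controlled by the moment generating function at
  \<open>\<theta> + s\<close> and \<open>\<theta> - s\<close>.\<close>

lemma eventually_near_ge:
  assumes Y: "\<And>n. random_variable borel (Y n)" and a: "filterlim a at_top sequentially"
    and mgf: "mgf_limit a Y \<theta> l" "mgf_limit a Y (\<theta> + s) u" "mgf_limit a Y (\<theta> - s) v"
    and "s > 0" and gap: "u - s * (\<xi> + \<delta>) < l" "v + s * (\<xi> - \<delta>) < l" and "\<epsilon> > 0"
  shows "eventually (\<lambda>n. prob {\<omega> \<in> space M. \<bar>Y n \<omega> - \<xi>\<bar> < \<delta>} \<ge>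
    exp (- (a n * (\<theta> * \<xi> - l + \<bar>\<theta>\<bar> * \<delta> + \<epsilon>)))) sequentially"
proof -
  \<comment> \<open>The tails lie \<open>3 * \<eta>\<close> below \<open>l\<close>; the limit of the
    generating functions costs one \<open>\<eta>\<close>, so each tail is at most
    \<open>e = exp (a n * (l - 2 * \<eta>))\<close>. The full expectation is at least
    \<open>exp (a n * (l - \<eta>))\<close>, which exceeds \<open>4 * e\<close> for large
    \<open>n\<close>, so the part near \<open>\<xi>\<close> dominates.\<close>
  define \<eta> where "\<eta> = min (\<epsilon> / 2) (min ((l - (u - s * (\<xi> + \<delta>))) / 3) ((l - (v + s * (\<xi> - \<delta>))) / 3))"
  have \<eta>: "\<eta> > 0" "2 * \<eta> \<le> \<epsilon>" "u - s * (\<xi> + \<delta>) \<le> l - 3 * \<eta>" "v + s * (\<xi> - \<delta>) \<le> l - 3 * \<eta>"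
  proof -
    have "\<eta> \<le> \<epsilon> / 2" "\<eta> \<le> (l - (u - s * (\<xi> + \<delta>))) / 3" "\<eta> \<le> (l - (v + s * (\<xi> - \<delta>))) / 3"
      by (simp_all only: \<eta>_def min.cobounded1 min.coboundedI2 min.cobounded2 order_refl)
    moreover have "t \<le> l - 3 * \<eta>" if "\<eta> \<le> (l - t) / 3" for t
      using that by simp
    ultimately show "2 * \<eta> \<le> \<epsilon>" "u - s * (\<xi> + \<delta>) \<le> l - 3 * \<eta>"
      "v + s * (\<xi> - \<delta>) \<le> l - 3 * \<eta>"
      by simp_all
    show "\<eta> > 0" using gap \<open>\<epsilon> > 0\<close> by (simp add: \<eta>_def)
  qed
  have "eventually (\<lambda>n. a n \<ge> ln 4 / \<eta>) sequentially" "eventually (\<lambda>n. a n > 0) sequentially"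
    using a[unfolded filterlim_at_top] a[unfolded filterlim_at_top_dense] by auto
  with mgf_limit_bounds[OF mgf(1) a \<eta>(1)] mgf_limit_bounds[OF mgf(2) a \<eta>(1)]
    mgf_limit_bounds[OF mgf(3) a \<eta>(1)]
  show ?thesis
  proof eventually_elim
    case (elim n)
    note [measurable] = Y[of n]
    define A where "A = {\<omega> \<in> space M. \<bar>Y n \<omega> - \<xi>\<bar> < \<delta>}"
    \<comment> \<open>\<open>c\<close> bounds the exponential on \<open>A\<close>; \<open>cu\<close>
      and \<open>cv\<close> normalise the additional tilts \<open>s\<close> and \<open>- s\<close>
      to equal 1 at \<open>\<xi> + \<delta>\<close> and \<open>\<xi> - \<delta>\<close>, so that
      they are at least 1 beyond these points.\<close>
    define c where "c = exp (a n * (\<theta> * \<xi> + \<bar>\<theta>\<bar> * \<delta>))"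
    define cu where "cu = exp (- (a n * s * (\<xi> + \<delta>)))"
    define cv where "cv = exp (a n * s * (\<xi> - \<delta>))"
    have [measurable]: "A \<in> sets M" unfolding A_def by measurable
    have pointwise: "exp (a n * \<theta> * Y n \<omega>) \<le> c * indicator A \<omega> +
        cu * exp (a n * (\<theta> + s) * Y n \<omega>) + cv * exp (a n * (\<theta> - s) * Y n \<omega>)"
      if "\<omega> \<in> space M" for \<omega>
    proof -
      let ?y = "Y n \<omega>"
      have nonneg: "c * indicator A \<omega> \<ge> 0" "cu * exp (a n * (\<theta> + s) * ?y) \<ge> 0"
        "cv * exp (a n * (\<theta> - s) * ?y) \<ge> 0"
        by (simp_all add: c_def cu_def cv_def)
      have "\<omega> \<in> A \<or> ?y \<ge> \<xi> + \<delta> \<or> ?y \<le> \<xi> - \<delta>"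
        using that by (simp add: A_def) linarith
      then consider "\<omega> \<in> A" | "?y \<ge> \<xi> + \<delta>" | "?y \<le> \<xi> - \<delta>" by blast
      then show ?thesis
      proof cases
        case 1
        then have "\<bar>?y - \<xi>\<bar> \<le> \<delta>" by (simp add: A_def)
        then have "\<theta> * (?y - \<xi>) \<le> \<bar>\<theta>\<bar> * \<delta>"
          by (metis abs_ge_self abs_ge_zero abs_mult mult_left_mono order_trans)
        then have "a n * (\<theta> * ?y) \<le> a n * (\<theta> * \<xi> + \<bar>\<theta>\<bar> * \<delta>)"
          using elim by (intro mult_left_mono) (auto simp: algebra_simps)
        then have "exp (a n * \<theta> * ?y) \<le> c" by (simp add: c_def mult.assoc)
        with 1 nonneg show ?thesis by simp
      next
        case 2
        then have "a n * s * (\<xi> + \<delta>) \<le> a n * s * ?y"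
          using elim \<open>s > 0\<close> by (intro mult_left_mono) auto
        then have "exp (a n * \<theta> * ?y) \<le> cu * exp (a n * (\<theta> + s) * ?y)"
          unfolding cu_def exp_add[symmetric] by (simp add: algebra_simps)
        with nonneg show ?thesis by linarith
      next
        case 3
        then have "a n * s * ?y \<le> a n * s * (\<xi> - \<delta>)"
          using elim \<open>s > 0\<close> by (intro mult_left_mono) auto
        then have "exp (a n * \<theta> * ?y) \<le> cv * exp (a n * (\<theta> - s) * ?y)"
          unfolding cv_def exp_add[symmetric] by (simp add: algebra_simps)
        with nonneg show ?thesis by linarith
      qed
    qed
    let ?E = "\<lambda>t. expectation (\<lambda>\<omega>. exp (a n * t * Y n \<omega>))"
    have int: "integrable M (indicat_real A)"
      by (rule integrable_real_indicator) (auto simp: emeasure_eq_measure)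
    define e where "e = exp (a n * (l - 2 * \<eta>))"
    have tails: "cu * ?E (\<theta> + s) \<le> e" "cv * ?E (\<theta> - s) \<le> e"
    proof -
      have "cu * ?E (\<theta> + s) \<le> cu * exp (a n * (u + \<eta>))"
        using elim by (intro mult_left_mono) (auto simp: cu_def)
      also have "\<dots> = exp (a n * (u - s * (\<xi> + \<delta>) + \<eta>))"
        by (simp add: cu_def exp_add[symmetric] algebra_simps)
      also have "\<dots> \<le> e"
        using elim \<eta> by (simp add: e_def)
      finally show "cu * ?E (\<theta> + s) \<le> e" .
      have "cv * ?E (\<theta> - s) \<le> cv * exp (a n * (v + \<eta>))"
        using elim by (intro mult_left_mono) (auto simp: cv_def)
      also have "\<dots> = exp (a n * (v + s * (\<xi> - \<delta>) + \<eta>))"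
        by (simp add: cv_def exp_add[symmetric] algebra_simps)
      also have "\<dots> \<le> e"
        using elim \<eta> by (simp add: e_def)
      finally show "cv * ?E (\<theta> - s) \<le> e" .
    qed
    have "ln 4 \<le> a n * \<eta>" using elim(4) \<eta>(1) by (simp add: field_simps)
    then have "exp (ln 4) \<le> exp (a n * \<eta>)" by (simp only: exp_le_cancel_iff)
    then have "e * 4 \<le> e * exp (a n * \<eta>)" by (intro mult_left_mono) (auto simp: e_def)
    also have "\<dots> = exp (a n * (l - \<eta>))" by (simp add: e_def exp_add[symmetric] algebra_simps)
    also have "\<dots> \<le> ?E \<theta>" using elim by simp
    also have "\<dots> \<le> expectation (\<lambda>\<omega>. c * indicator A \<omega> +
        cu * exp (a n * (\<theta> + s) * Y n \<omega>) + cv * exp (a n * (\<theta> - s) * Y n \<omega>))"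
      using elim pointwise int
      by (intro integral_mono Bochner_Integration.integrable_add integrable_mult_right) auto
    also have "\<dots> = c * prob A + cu * ?E (\<theta> + s) + cv * ?E (\<theta> - s)"
      using elim int by simp
    finally have "e * 4 \<le> c * prob A + cu * ?E (\<theta> + s) + cv * ?E (\<theta> - s)" .
    moreover have "e > 0" by (simp add: e_def)
    ultimately have "e \<le> c * prob A" using tails by linarith
    then have "e / c \<le> prob A" by (simp add: c_def field_simps)
    moreover have "exp (- (a n * (\<theta> * \<xi> - l + \<bar>\<theta>\<bar> * \<delta> + \<epsilon>))) \<le> e / c"
    proof -
      have "a n * (2 * \<eta>) \<le> a n * \<epsilon>" using elim \<eta> by (intro mult_left_mono) auto
      then show ?thesis by (simp add: e_def c_def exp_diff[symmetric] algebra_simps)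
    qed
    ultimately show ?case unfolding A_def by linarith
  qed
qed

end

text \<open>Abstract in \<open>Y\<close> because it is instantiated twice: with the full average for
  the upper bound, and with the average lacking its last term for the lower bound.\<close>

locale window_mgf = window T + prob_space M for T and M :: "'a measure" +
  fixes a :: "nat \<Rightarrow> real" and Y :: "nat \<Rightarrow> 'a \<Rightarrow> real"
  assumes a: "filterlim a at_top sequentially"
    and Y: "\<And>n. random_variable borel (Y n)"
    and mgf: "\<And>\<theta>. \<theta> \<ge> \<theta>\<^sub>0 \<Longrightarrow> mgf_limit a Y \<theta> (L \<theta>)"
begin

text \<open>Strictly to the right of \<open>\<theta>\<^sub>0\<close> there are admissible tilts on
  both sides of \<open>\<theta>\<close>, which the two-sided tail estimate demands.\<close>

lemma near_D_ge:
  assumes "\<theta> > \<theta>\<^sub>0" "\<delta> > 0" "\<epsilon> > 0"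
  shows "eventually (\<lambda>n. prob {\<omega> \<in> space M. \<bar>Y n \<omega> - D \<theta>\<bar> < \<delta>} \<ge>
    exp (- (a n * (\<theta> * D \<theta> - L \<theta> + \<epsilon>)))) sequentially"
proof -
  define \<delta>' where "\<delta>' = min \<delta> (\<epsilon> / (2 * (\<bar>\<theta>\<bar> + 1)))"
  have \<delta>': "\<delta>' > 0" "\<delta>' \<le> \<delta>" using assms by (auto simp: \<delta>'_def)
  have "\<bar>\<theta>\<bar> * \<delta>' \<le> (\<bar>\<theta>\<bar> + 1) * (\<epsilon> / (2 * (\<bar>\<theta>\<bar> + 1)))"
    using \<delta>' by (intro mult_mono) (auto simp: \<delta>'_def)
  also have "\<dots> = \<epsilon> / 2" by (simp add: field_simps)
  finally have \<theta>\<delta>': "\<bar>\<theta>\<bar> * \<delta>' \<le> \<epsilon> / 2" .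
  have "((\<lambda>h. (L (\<theta> + h) - L \<theta>) / h) \<longlongrightarrow> D \<theta>) (at 0)"
    using L_has_derivative[OF assms(1)] by (simp add: DERIV_def)
  from LIM_D[OF this \<delta>'(1)] obtain d where d: "d > 0"
    "\<And>h. h \<noteq> 0 \<Longrightarrow> \<bar>h\<bar> < d \<Longrightarrow> \<bar>(L (\<theta> + h) - L \<theta>) / h - D \<theta>\<bar> < \<delta>'"
    unfolding real_norm_def diff_zero by blast
  \<comment> \<open>To first order \<open>L (\<theta> + s)\<close> and
    \<open>L (\<theta> - s)\<close> differ from \<open>L \<theta>\<close> by
    \<open>s * D \<theta>\<close> with opposite signs; for \<open>s < d\<close> the remainder is
    below \<open>s * \<delta>'\<close>. The bound \<open>\<theta> - \<theta>\<^sub>0\<close> keeps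
    \<open>\<theta> - s\<close> admissible.\<close>
  define s where "s = min (d / 2) (\<theta> - \<theta>\<^sub>0)"
  have s: "s > 0" "s < d" "s \<le> \<theta> - \<theta>\<^sub>0" using d(1) assms(1) by (auto simp: s_def)
  have gap: "L (\<theta> + s) - s * (D \<theta> + \<delta>') < L \<theta>" "L (\<theta> - s) + s * (D \<theta> - \<delta>') < L \<theta>"
    using d(2)[of s] d(2)[of "- s"] s by (auto simp: abs_less_iff field_simps)
  have "eventually (\<lambda>n. prob {\<omega> \<in> space M. \<bar>Y n \<omega> - D \<theta>\<bar> < \<delta>'} \<ge>
      exp (- (a n * (\<theta> * D \<theta> - L \<theta> + \<bar>\<theta>\<bar> * \<delta>' + \<epsilon> / 2)))) sequentially"
    using s assms by (intro eventually_near_ge[OF Y a mgf mgf mgf s(1) gap]) auto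
  moreover have "eventually (\<lambda>n. a n > 0) sequentially"
    using a by (simp add: filterlim_at_top_dense)
  ultimately show ?thesis
  proof eventually_elim
    case (elim n)
    note [measurable] = Y[of n]
    have "a n * (\<theta> * D \<theta> - L \<theta> + \<bar>\<theta>\<bar> * \<delta>' + \<epsilon> / 2) \<le> a n * (\<theta> * D \<theta> - L \<theta> + \<epsilon>)"
      using elim \<theta>\<delta>' by (intro mult_left_mono) auto
    then have "exp (- (a n * (\<theta> * D \<theta> - L \<theta> + \<epsilon>))) \<le>
        exp (- (a n * (\<theta> * D \<theta> - L \<theta> + \<bar>\<theta>\<bar> * \<delta>' + \<epsilon> / 2)))" by simp
    also have "\<dots> \<le> prob {\<omega> \<in> space M. \<bar>Y n \<omega> - D \<theta>\<bar> < \<delta>'}" using elim by simp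
    also have "\<dots> \<le> prob {\<omega> \<in> space M. \<bar>Y n \<omega> - D \<theta>\<bar> < \<delta>}"
      using \<delta>' by (intro finite_measure_mono) auto
    finally show ?case .
  qed
qed

lemma ldp_upper_bound:
  assumes "closed F"
  shows "limsup (\<lambda>n. ereal_ln (measure (distr M borel (Y n)) F) * ereal (1 / a n)) \<le>
    - (INF x\<in>F. ereal (rate x))"
proof (cases "F = {}")
  case True
  have ev: "eventually (\<lambda>n. a n > 0) sequentially"
    using a by (simp add: filterlim_at_top_dense)
  have "limsup (\<lambda>n. ereal_ln (measure (distr M borel (Y n)) F) * ereal (1 / a n)) \<le> - \<infinity>"
    by (rule Limsup_bounded, rule eventually_mono[OF ev]) (simp add: True ereal_ln_def)
  with True show ?thesis by (simp add: top_ereal_def)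
next
  case False
  let ?c = "D 0"
  \<comment> \<open>\<open>x\<close> and \<open>y\<close> are the points of \<open>F\<close> nearest
    to the typical value from below and from above, so \<open>F\<close> lies in two half-lines
    pointing away from it. If \<open>F\<close> lies on one side only, its nearest point plays both
    parts.\<close>
  have "\<exists>x\<in>F. \<exists>y\<in>F. \<forall>u\<in>F. u \<le> x \<and> x \<le> ?c \<or> u \<ge> y \<and> y \<ge> ?c"
  proof -
    define A where "A = F \<inter> {..?c}"
    define B where "B = F \<inter> {?c..}"
    have cl: "closed A" "closed B" using assms by (auto simp: A_def B_def)
    have bdd: "bdd_above A" "bdd_below B" by (auto simp: A_def B_def)
    have A: "Sup A \<in> A" "\<And>u. u \<in> A \<Longrightarrow> u \<le> Sup A" if "A \<noteq> {}"
      using that cl bdd by (auto intro: closed_contains_Sup cSup_upper)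
    have B: "Inf B \<in> B" "\<And>u. u \<in> B \<Longrightarrow> Inf B \<le> u" if "B \<noteq> {}"
      using that cl bdd by (auto intro: closed_contains_Inf cInf_lower)
    have AB: "u \<in> A \<or> u \<in> B" if "u \<in> F" for u using that by (auto simp: A_def B_def)
    have sub: "u \<in> F \<and> u \<le> ?c" if "u \<in> A" for u using that by (simp add: A_def)
    have sub': "u \<in> F \<and> ?c \<le> u" if "u \<in> B" for u using that by (simp add: B_def)
    define x where "x = (if A = {} then Inf B else Sup A)"
    define y where "y = (if B = {} then Sup A else Inf B)"
    have "A \<noteq> {} \<or> B \<noteq> {}" using False AB by blast
    then have "x \<in> F" "y \<in> F" using A(1) B(1) sub sub' by (auto simp: x_def y_def)
    moreover have "u \<le> x \<and> x \<le> ?c \<or> u \<ge> y \<and> y \<ge> ?c" if "u \<in> F" for u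
      using AB[OF that]
    proof
      assume "u \<in> A"
      then have "A \<noteq> {}" by blast
      then show ?thesis using A(2)[OF _ \<open>u \<in> A\<close>] sub[OF A(1)] by (simp add: x_def)
    next
      assume "u \<in> B"
      then have "B \<noteq> {}" by blast
      then show ?thesis using B(2)[OF _ \<open>u \<in> B\<close>] sub'[OF B(1)] by (simp add: y_def)
    qed
    ultimately show ?thesis by blast
  qed
  then obtain x y where xy: "x \<in> F" "y \<in> F" "\<And>u. u \<in> F \<Longrightarrow> u \<le> x \<and> x \<le> ?c \<or> u \<ge> y \<and> y \<ge> ?c"
    by blast
  define z where "z = (if rate x \<le> rate y then x else y)"
  have z: "z \<in> F" "rate z \<le> rate x" "rate z \<le> rate y" using xy by (auto simp: z_def)
  have "limsup (\<lambda>n. ereal_ln (measure (distr M borel (Y n)) F) * ereal (1 / a n)) \<le> - ereal (rate z)"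
  proof (rule limsup_ereal_ln_le[OF a])
    fix \<epsilon> :: real assume "\<epsilon> > 0"
    then have "\<epsilon> / 2 > 0" by simp
    have tail: "eventually (\<lambda>n. prob {\<omega> \<in> space M. \<tau> x * Y n \<omega> \<ge> \<tau> x * x}
        \<le> exp (- (a n * (rate x - \<epsilon> / 2)))) sequentially" for x
      unfolding rate_def by (rule eventually_tail_le[OF Y mgf[OF \<tau>(1)] a \<open>\<epsilon> / 2 > 0\<close>])
    \<comment> \<open>Half of \<open>\<epsilon>\<close> absorbs the factor 2 of the union bound,
      half the Chernoff error.\<close>
    have "eventually (\<lambda>n. a n \<ge> 2 * ln 2 / \<epsilon>) sequentially" "eventually (\<lambda>n. a n > 0) sequentially"
      using a[unfolded filterlim_at_top] a[unfolded filterlim_at_top_dense] by auto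
    with tail[of x] tail[of y]
    show "eventually (\<lambda>n. measure (distr M borel (Y n)) F \<le> exp (- (a n * (rate z - \<epsilon>)))) sequentially"
    proof eventually_elim
      case (elim n)
      note [measurable] = Y[of n]
      have F: "F \<in> sets borel" using assms by simp
      have "measure (distr M borel (Y n)) F = prob (Y n -` F \<inter> space M)"
        using F by (simp add: measure_distr)
      also have "\<dots> \<le> prob ({\<omega> \<in> space M. \<tau> x * Y n \<omega> \<ge> \<tau> x * x} \<union> {\<omega> \<in> space M. \<tau> y * Y n \<omega> \<ge> \<tau> y * y})"
      proof (intro finite_measure_mono subsetI)
        fix \<omega> assume "\<omega> \<in> Y n -` F \<inter> space M"
        then have \<omega>: "\<omega> \<in> space M" "Y n \<omega> \<in> F" by auto
        from xy(3)[OF \<omega>(2)] have "\<tau> x * Y n \<omega> \<ge> \<tau> x * x \<or> \<tau> y * Y n \<omega> \<ge> \<tau> y * y"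
        proof (elim disjE conjE)
          assume "Y n \<omega> \<le> x" "x \<le> ?c"
          then have "\<tau> x \<le> 0" using \<tau>_mono[of x ?c] by (simp add: \<tau>_D_0)
          with \<open>Y n \<omega> \<le> x\<close> show ?thesis by (auto intro: mult_left_mono_neg)
        next
          assume "Y n \<omega> \<ge> y" "y \<ge> ?c"
          then have "\<tau> y \<ge> 0" using \<tau>_mono[of ?c y] by (simp add: \<tau>_D_0)
          with \<open>Y n \<omega> \<ge> y\<close> show ?thesis by (auto intro: mult_left_mono)
        qed
        with \<omega> show "\<omega> \<in> {\<omega> \<in> space M. \<tau> x * Y n \<omega> \<ge> \<tau> x * x} \<union> {\<omega> \<in> space M. \<tau> y * Y n \<omega> \<ge> \<tau> y * y}"
          by auto
      qed measurable
      also have "\<dots> \<le> prob {\<omega> \<in> space M. \<tau> x * Y n \<omega> \<ge> \<tau> x * x} + prob {\<omega> \<in> space M. \<tau> y * Y n \<omega> \<ge> \<tau> y * y}"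
        by (rule measure_Un_le) measurable
      also have "\<dots> \<le> exp (- (a n * (rate x - \<epsilon> / 2))) + exp (- (a n * (rate y - \<epsilon> / 2)))"
        using elim by (intro add_mono) auto
      also have "\<dots> \<le> exp (- (a n * (rate z - \<epsilon> / 2))) + exp (- (a n * (rate z - \<epsilon> / 2)))"
        using elim z by (intro add_mono) auto
      also have "\<dots> = 2 * exp (- (a n * (rate z - \<epsilon> / 2)))" by simp
      also have "\<dots> \<le> exp (a n * (\<epsilon> / 2)) * exp (- (a n * (rate z - \<epsilon> / 2)))"
      proof (rule mult_right_mono)
        have "ln 2 \<le> a n * (\<epsilon> / 2)" using elim(3) \<open>\<epsilon> > 0\<close> by (simp add: field_simps)
        then have "exp (ln 2) \<le> exp (a n * (\<epsilon> / 2))" by (simp only: exp_le_cancel_iff)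
        then show "2 \<le> exp (a n * (\<epsilon> / 2))" by simp
      qed simp
      also have "\<dots> = exp (- (a n * (rate z - \<epsilon>)))"
        by (simp add: exp_add[symmetric] algebra_simps)
      finally show ?case .
    qed
  qed
  also have "\<dots> \<le> - (INF x\<in>F. ereal (rate x))"
    using INF_lower[OF z(1), of "\<lambda>x. ereal (rate x)"] by (simp only: ereal_minus_le_minus)
  finally show ?thesis .
qed

end

section \<open>Small values of gamma variables\<close>

lemma (in prob_space) gamma_small_interval:
  fixes X :: "'a \<Rightarrow> real"
  assumes X: "distributed M lborel X (gamma_density \<kappa> (1 / 2))"
    and \<kappa>: "\<kappa> \<ge> 1" and u: "u > 0"
  shows "exp (\<kappa> * ln (u / 2) - u - ln_Gamma \<kappa>) \<le> prob {\<omega> \<in> space M. u \<le> X \<omega> \<and> X \<omega> \<le> 2 * u}"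
proof -
  \<comment> \<open>A lower bound for the density on \<open>{u..2 * u}\<close>: the power is
    smallest at the left end, as \<open>\<kappa> \<ge> 1\<close>, and the exponential at the right
    end.\<close>
  define c where "c = (1 / 2) powr \<kappa> * u powr (\<kappa> - 1) * exp (- u) / Gamma \<kappa>"
  have c: "c \<ge> 0" using \<kappa> by (simp add: c_def)
  have "exp (\<kappa> * ln (u / 2) - u - ln_Gamma \<kappa>) = c * u"
  proof -
    have "c * u = exp (\<kappa> * ln (1 / 2) + (\<kappa> - 1) * ln u + (- u) - ln_Gamma \<kappa> + ln u)"
      using u \<kappa> by (simp add: c_def exp_add exp_diff exp_minus powr_def Gamma_real_pos_exp field_simps)
    also have "\<kappa> * ln (1 / 2) + (\<kappa> - 1) * ln u + (- u) - ln_Gamma \<kappa> + ln u =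
        \<kappa> * ln (u / 2) - u - ln_Gamma \<kappa>"
      using u by (simp add: ln_div algebra_simps)
    finally show ?thesis by simp
  qed
  also have "ennreal (c * u) = (\<integral>\<^sup>+x. ennreal c * indicator {u..2 * u} x \<partial>lborel)"
    using u c by (simp add: nn_integral_cmult_indicator ennreal_mult')
  also have "\<dots> \<le> (\<integral>\<^sup>+x. gamma_density \<kappa> (1 / 2) x * indicator {u..2 * u} x \<partial>lborel)"
  proof (intro nn_integral_mono)
    fix x :: real
    show "ennreal c * indicator {u..2 * u} x \<le> gamma_density \<kappa> (1 / 2) x * indicator {u..2 * u} x"
    proof (cases "x \<in> {u..2 * u}")
      case True
      then have "c \<le> (1 / 2) powr \<kappa> * x powr (\<kappa> - 1) * exp (- (1 / 2) * x) / Gamma \<kappa>"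
        unfolding c_def using u \<kappa> by (intro divide_right_mono mult_mono powr_mono2) auto
      with True u show ?thesis by (simp add: gamma_density_def ennreal_leI)
    qed simp
  qed
  also have "\<dots> = emeasure M (X -` {u..2 * u} \<inter> space M)"
    by (rule distributed_emeasure[OF X, symmetric]) simp
  also have "X -` {u..2 * u} \<inter> space M = {\<omega> \<in> space M. u \<le> X \<omega> \<and> X \<omega> \<le> 2 * u}" by auto
  finally show ?thesis
    by (simp add: emeasure_eq_measure)
qed

text \<open>Shows that the normalising constant of a gamma density with shape of order
  \<open>n\<close> is negligible at speed \<open>n\<^sup>2\<close>.\<close>

lemma ln_Gamma_div_square_tendsto_0: "((\<lambda>z::real. ln_Gamma z / z\<^sup>2) \<longlongrightarrow> 0) at_top"
proof -
  obtain C where C: "\<And>z::real. z \<ge> 1 \<Longrightarrow> \<bar>ln_Gamma z - (z * ln z - z)\<bar> \<le> C * (1 + \<bar>ln z\<bar>)"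
    using ln_Gamma_weak_stirling[of 1] by auto
  have "((\<lambda>z::real. (z * ln z + z + C * (1 + ln z)) / z\<^sup>2) \<longlongrightarrow> 0) at_top"
    by real_asymp
  moreover have "eventually (\<lambda>z::real. norm (ln_Gamma z / z\<^sup>2) \<le> (z * ln z + z + C * (1 + ln z)) / z\<^sup>2) at_top"
    using eventually_ge_at_top[of 1]
  proof eventually_elim
    case (elim z)
    then have "\<bar>ln z\<bar> = ln z" "z * ln z \<ge> 0" by simp_all
    with C[OF elim] elim have "\<bar>ln_Gamma z\<bar> \<le> z * ln z + z + C * (1 + ln z)"
      by linarith
    then show ?case by (simp add: divide_right_mono)
  qed
  ultimately show ?thesis by (rule Lim_null_comparison[rotated])
qed

text \<open>The event forces the variable down to about \<open>2 * b * n * exp (- (n * c))\<close>;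
  raising this level to the shape, about \<open>b * n * l\<close>, yields the exponent
  \<open>b * n\<^sup>2 * l * c\<close>, and all other factors are of lower order.\<close>

lemma (in prob_space) eventually_log_gamma_near_ge:
  fixes X :: "nat \<Rightarrow> 'a \<Rightarrow> real" and q :: "nat \<Rightarrow> real" and b l c \<delta> \<epsilon> :: real
  assumes X: "eventually (\<lambda>n. distributed M lborel (X n) (gamma_density (b * q n) (1 / 2))) sequentially"
    and b: "b > 0" and q: "(\<lambda>n. q n / n) \<longlonglongrightarrow> l" and l: "l > 0"
    and c: "c > 0" and \<delta>: "\<delta> > 0" and \<epsilon>: "\<epsilon> > 0"
  shows "eventually (\<lambda>n. exp (- (b * (real n)\<^sup>2 * (l * c + \<epsilon>))) \<le>
    prob {\<omega> \<in> space M. \<bar>1 / n * ln (X n \<omega> / (2 * b * n)) - (- c)\<bar> < \<delta>}) sequentially"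
proof -
  define e where "e n = b * q n * (ln (b * n) - n * c) - 2 * b * n * exp (- (n * c)) - ln_Gamma (b * q n)" for n
  have q_top: "filterlim (\<lambda>n. b * q n) at_top sequentially"
  proof -
    have "filterlim (\<lambda>n. q n / real n * real n) at_top sequentially"
      using filterlim_tendsto_pos_mult_at_top[OF q l filterlim_real_sequentially] .
    then have "filterlim (\<lambda>n. b * (q n / real n * real n)) at_top sequentially"
      by (rule filterlim_tendsto_pos_mult_at_top[OF tendsto_const b])
    moreover have "eventually (\<lambda>n. b * (q n / real n * real n) = b * q n) sequentially"
      using eventually_gt_at_top[of 0] by eventually_elim simp
    ultimately show ?thesis by (rule filterlim_cong[OF refl refl, THEN iffD1, rotated])
  qed
  have "(\<lambda>n. (q n / n) * (ln (b * n) / n - c) - 2 * (exp (- (n * c)) / n) -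
      ln_Gamma (b * q n) / (b * q n)\<^sup>2 * (b * (q n / n)\<^sup>2)) \<longlonglongrightarrow> l * (0 - c) - 2 * 0 - 0 * (b * l\<^sup>2)"
  proof (intro tendsto_intros q)
    show "(\<lambda>n. ln (b * real n) / real n) \<longlonglongrightarrow> 0" using b by real_asymp
    show "(\<lambda>n. exp (- (real n * c)) / real n) \<longlonglongrightarrow> 0" using c by real_asymp
    show "(\<lambda>n. ln_Gamma (b * q n) / (b * q n)\<^sup>2) \<longlonglongrightarrow> 0"
      by (rule filterlim_compose[OF ln_Gamma_div_square_tendsto_0 q_top])
  qed
  then have "eventually (\<lambda>n. (q n / n) * (ln (b * n) / n - c) - 2 * (exp (- (n * c)) / n) -
      ln_Gamma (b * q n) / (b * q n)\<^sup>2 * (b * (q n / n)\<^sup>2) > - (l * c + \<epsilon>)) sequentially"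
    using \<epsilon> by (intro order_tendstoD(1)) auto
  moreover have "eventually (\<lambda>n. b * q n \<ge> 1) sequentially"
    using q_top by (simp add: filterlim_at_top)
  \<comment> \<open>The interval from \<open>u\<close> to \<open>2 * u\<close> has logarithmic width
    \<open>ln 2\<close>, which shrinks to \<open>ln 2 / n\<close> after scaling.\<close>
  moreover have "eventually (\<lambda>n. ln 2 / real n < \<delta>) sequentially"
  proof -
    have "(\<lambda>n. ln 2 / real n) \<longlonglongrightarrow> 0" by real_asymp
    from order_tendstoD(2)[OF this \<delta>] show ?thesis .
  qed
  ultimately show ?thesis using X eventually_gt_at_top[of 0]
  proof eventually_elim
    case (elim n)
    define u where "u = 2 * b * n * exp (- (n * c))"
    have u: "u > 0" using b elim by (simp add: u_def)
    have bn2: "b * (real n)\<^sup>2 > 0" using b elim by simp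
    have [measurable]: "random_variable borel (X n)"
      using elim by (auto dest: distributed_measurable)
    have qn: "q n \<noteq> 0" using elim by auto
    have "e n = b * n\<^sup>2 * ((q n / n) * (ln (b * n) / n - c) - 2 * (exp (- (n * c)) / n) -
        ln_Gamma (b * q n) / (b * q n)\<^sup>2 * (b * (q n / n)\<^sup>2))"
      using b elim qn by (simp add: e_def field_simps power2_eq_square)
    also have "\<dots> \<ge> b * n\<^sup>2 * (- (l * c + \<epsilon>))"
      using elim bn2 by (intro mult_left_mono) auto
    finally have "exp (- (b * (real n)\<^sup>2 * (l * c + \<epsilon>))) \<le> exp (e n)"
      by (simp only: mult_minus_right exp_le_cancel_iff of_nat_power)
    also have "e n = (b * q n) * ln (u / 2) - u - ln_Gamma (b * q n)"
      using b elim by (simp add: e_def u_def ln_mult_pos)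
    also have "exp \<dots> \<le> prob {\<omega> \<in> space M. u \<le> X n \<omega> \<and> X n \<omega> \<le> 2 * u}"
      using elim u by (intro gamma_small_interval) auto
    also have "\<dots> \<le> prob {\<omega> \<in> space M. \<bar>1 / n * ln (X n \<omega> / (2 * b * n)) - (- c)\<bar> < \<delta>}"
    proof (intro finite_measure_mono subsetI)
      fix \<omega> assume "\<omega> \<in> {\<omega> \<in> space M. u \<le> X n \<omega> \<and> X n \<omega> \<le> 2 * u}"
      then have \<omega>: "\<omega> \<in> space M" "u \<le> X n \<omega>" "X n \<omega> \<le> 2 * u" by auto
      have pos: "2 * b * n > 0" using b elim by simp
      let ?x = "X n \<omega> / (2 * b * n)"
      have "exp (- (n * c)) \<le> ?x" "?x \<le> 2 * exp (- (n * c))"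
        using \<omega> pos by (simp_all add: u_def field_simps)
      moreover from this have "?x > 0" by (meson exp_gt_zero less_le_trans)
      ultimately have "- (n * c) \<le> ln ?x" "ln ?x \<le> ln (2 * exp (- (n * c)))"
        by (simp only: ln_ge_iff, intro ln_mono) auto
      then have "- (n * c) \<le> ln ?x" "ln ?x \<le> ln 2 - n * c" by (simp_all add: ln_mult_pos)
      then have "0 \<le> (ln ?x + n * c) / n" "(ln ?x + n * c) / n \<le> ln 2 / n"
        by (auto intro!: divide_nonneg_nonneg divide_right_mono)
      then have "0 \<le> ln ?x / n + c" "ln ?x / n + c \<le> ln 2 / n"
        using elim by (simp_all add: add_divide_distrib)
      with elim \<omega> show "\<omega> \<in> {\<omega> \<in> space M. \<bar>1 / n * ln (X n \<omega> / (2 * b * n)) - (- c)\<bar> < \<delta>}"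
        by simp
    qed measurable
    finally show ?case .
  qed
qed

section \<open>The large deviation principle\<close>

locale log_gamma_window = window T + prob_space M for T and M :: "'a measure" +
  fixes b :: real and \<rho> :: "nat \<Rightarrow> nat \<Rightarrow> 'a \<Rightarrow> real"
  assumes b: "b > 0"
    and indep: "\<And>n. n \<ge> 1 \<Longrightarrow> indep_vars (\<lambda>_. borel) (\<rho> n) {1..n}"
    and gamma: "\<And>n k. 1 \<le> k \<Longrightarrow> k \<le> n \<Longrightarrow>
      distributed M lborel (\<rho> n k) (gamma_density (b * real (n - k + 1)) (1 / 2))"
begin

text \<open>With \<open>b = \<beta> / 2\<close> the normalisation \<open>2 * b * n\<close> is
  \<open>\<beta> * n\<close>. The number \<open>m\<close> of terms is free so that the last one can
  be split off.\<close>

definition log_avg :: "nat \<Rightarrow> nat \<Rightarrow> 'a \<Rightarrow> real" where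
  "log_avg m n \<omega> = (1 / real n) * (\<Sum>k=1..m. ln (\<rho> n k \<omega> / (2 * b * n)))"

abbreviation speed :: "nat \<Rightarrow> real" where
  "speed n \<equiv> b * (real n)\<^sup>2"

lemma speed_at_top: "filterlim speed at_top sequentially"
  using b by real_asymp

lemma random_variable_\<rho>: "1 \<le> k \<Longrightarrow> k \<le> n \<Longrightarrow> random_variable borel (\<rho> n k)"
  using distributed_measurable[OF gamma] by simp

lemma random_variable_log_avg:
  assumes "m \<le> n" shows "random_variable borel (log_avg m n)"
  unfolding log_avg_def using assms
  by (intro borel_measurable_times borel_measurable_sum borel_measurable_const borel_measurable_ln
      borel_measurable_divide random_variable_\<rho>) auto

lemma window_mgf_log_avg:
  fixes m :: "nat \<Rightarrow> nat"
  assumes m_le: "\<And>n. real (m n) \<le> real n * T"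
    and m_lim: "(\<lambda>n. real (m n) / real n) \<longlonglongrightarrow> T"
  shows "window_mgf T M speed (\<lambda>n. log_avg (m n) n)"
proof unfold_locales
  have m_le_n: "m n \<le> n" for n
    using m_le[of n] T_less_1 mult_left_mono[of T 1 "real n"] by simp
  show "filterlim speed at_top sequentially" by (rule speed_at_top)
  show "random_variable borel (log_avg (m n) n)" for n
    by (rule random_variable_log_avg[OF m_le_n])
  fix \<theta> assume \<theta>: "\<theta> \<ge> \<theta>\<^sub>0"
  show "mgf_limit speed (\<lambda>n. log_avg (m n) n) \<theta> (L \<theta>)"
    unfolding mgf_limit_def
  proof (intro exI conjI)
    show "(\<lambda>n. log_mgf b (m n) n \<theta> / speed n) \<longlonglongrightarrow> L \<theta>"
      by (rule log_mgf_tendsto[OF b \<theta> m_le m_lim])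
    show "eventually (\<lambda>n. has_bochner_integral M (\<lambda>\<omega>. exp (speed n * \<theta> * log_avg (m n) n \<omega>))
        (exp (log_mgf b (m n) n \<theta>))) sequentially"
      using eventually_gt_at_top[of 0]
    proof eventually_elim
      case (elim n)
      have "real n * T \<le> real n * (1 + \<theta>)"
        using \<theta> by (intro mult_left_mono) (auto simp: \<theta>\<^sub>0_def)
      then have "real n * (1 + \<theta>) > real (m n) - 1" using m_le[of n] by linarith
      from gamma_sum_log_mgf[OF indep gamma b elim m_le_n this]
      have "has_bochner_integral M
        (\<lambda>\<omega>. exp (b * n * \<theta> * (\<Sum>k=1..m n. ln (\<rho> n k \<omega> / (2 * b * n))))) (exp (log_mgf b (m n) n \<theta>))"
        using elim by simp
      also have "(\<lambda>\<omega>. exp (b * n * \<theta> * (\<Sum>k=1..m n. ln (\<rho> n k \<omega> / (2 * b * n))))) =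
          (\<lambda>\<omega>. exp (speed n * \<theta> * log_avg (m n) n \<omega>))"
        using elim by (simp add: log_avg_def power2_eq_square mult_ac)
      finally show ?case .
    qed
  qed
qed

section \<open>The number of summands and its limiting proportion\<close>

definition last_index :: "nat \<Rightarrow> nat" where
  "last_index n = nat \<lfloor>real n * T\<rfloor>"

lemma last_index_bounds:
  "real (last_index n) \<le> real n * T" "real n * T - 1 < real (last_index n)"
  using T_pos by (simp_all add: last_index_def)

lemma last_index_le: "last_index n \<le> n"
  using last_index_bounds(1)[of n] T_less_1 mult_left_mono[of T 1 "real n"] by simp

lemma last_index_tendsto: "(\<lambda>n. real (last_index n) / real n) \<longlonglongrightarrow> T"
proof (rule tendsto_sandwich)
  show "(\<lambda>n. T - 1 / real n) \<longlonglongrightarrow> T"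
    using tendsto_diff[OF tendsto_const lim_1_over_n] by simp
  show "eventually (\<lambda>n. T - 1 / real n \<le> real (last_index n) / real n) sequentially"
    using eventually_gt_at_top[of 0]
  proof eventually_elim
    case (elim n)
    have "(real n * T - 1) / real n \<le> real (last_index n) / real n"
      using last_index_bounds(2)[of n] by (intro divide_right_mono) auto
    with elim show ?case by (simp add: diff_divide_distrib)
  qed
  show "eventually (\<lambda>n. real (last_index n) / real n \<le> T) sequentially"
    using eventually_gt_at_top[of 0]
  proof eventually_elim
    case (elim n)
    then show ?case using last_index_bounds(1)[of n] by (simp add: field_simps)
  qed
qed (rule tendsto_const)

lemma eventually_last_index_pos: "eventually (\<lambda>n. last_index n \<ge> 1) sequentially"
proof -
  have "eventually (\<lambda>n. real n \<ge> 1 / T) sequentially"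
    by (rule eventually_ge_at_top[THEN eventually_compose_filterlim[OF _ filterlim_real_sequentially]])
  then show ?thesis
  proof eventually_elim
    case (elim n)
    then have "1 \<le> real n * T" using T_pos by (simp add: field_simps)
    then show ?case by (simp add: last_index_def le_nat_iff)
  qed
qed

lemma pred_last_index_tendsto: "(\<lambda>n. real (last_index n - 1) / real n) \<longlonglongrightarrow> T"
proof (rule Lim_transform_eventually)
  show "(\<lambda>n. real (last_index n) / real n - 1 / real n) \<longlonglongrightarrow> T"
    using tendsto_diff[OF last_index_tendsto lim_1_over_n] by simp
  show "eventually (\<lambda>n. real (last_index n) / real n - 1 / real n = real (last_index n - 1) / real n) sequentially"
    using eventually_last_index_pos by eventually_elim (simp add: of_nat_diff diff_divide_distrib)
qed

text \<open>Below \<open>D \<theta>\<^sub>0\<close> tilting is of no use, since the limiting moment generating function is infinite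
  beyond \<open>\<theta>\<^sub>0\<close>. Instead the last summand alone moves the average from \<open>D \<theta>\<close> down to \<open>x\<close>,
  at linear cost \<open>(1 - T) * (D \<theta> - x)\<close>.\<close>

lemma ldp_lower_bound:
  assumes "open G"
  shows "- (INF x\<in>G. ereal (rate x)) \<le>
    liminf (\<lambda>n. ereal_ln (measure (distr M borel (log_avg (last_index n) n)) G) * ereal (1 / speed n))"
    (is "_ \<le> ?l")
proof -
  interpret Y: window_mgf T M speed "\<lambda>n. log_avg (last_index n - 1) n"
  proof (rule window_mgf_log_avg)
    show "real (last_index n - 1) \<le> real n * T" for n
      using last_index_bounds(1)[of n] by linarith
  qed (rule pred_last_index_tendsto)
  have "- ereal (rate x) \<le> ?l" if "x \<in> G" for x
  proof (rule le_liminf_ereal_ln[OF speed_at_top])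
    fix \<epsilon> :: real assume "\<epsilon> > 0"
    obtain \<delta> where \<delta>: "\<delta> > 0" "ball x \<delta> \<subseteq> G"
      using assms \<open>x \<in> G\<close> open_contains_ball by blast
    obtain \<theta> where \<theta>: "\<theta> > \<theta>\<^sub>0" "D \<theta> > x"
      "\<theta> * D \<theta> - L \<theta> + (1 - T) * (D \<theta> - x) < rate x + \<epsilon> / 2"
      using rate_approx[of "\<epsilon> / 2" x] \<open>\<epsilon> > 0\<close> by auto
    define c where "c = D \<theta> - x"
    have c: "c > 0" using \<theta> by (simp add: c_def)
    define Z where "Z n \<omega> = 1 / n * ln (\<rho> n (last_index n) \<omega> / (2 * b * n))" for n \<omega>
    let ?Y = "\<lambda>n. log_avg (last_index n - 1) n"
    have "eventually (\<lambda>n. exp (- (speed n * (\<theta> * D \<theta> - L \<theta> + \<epsilon> / 4))) \<le>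
        prob {\<omega> \<in> space M. \<bar>?Y n \<omega> - D \<theta>\<bar> < \<delta> / 2}) sequentially"
      using \<theta> \<delta> \<open>\<epsilon> > 0\<close> by (intro Y.near_D_ge) auto
    moreover have "eventually (\<lambda>n. exp (- (speed n * ((1 - T) * c + \<epsilon> / 4))) \<le>
        prob {\<omega> \<in> space M. \<bar>Z n \<omega> - (- c)\<bar> < \<delta> / 2}) sequentially"
      unfolding Z_def
    proof (rule eventually_log_gamma_near_ge)
      show "eventually (\<lambda>n. distributed M lborel (\<rho> n (last_index n))
          (gamma_density (b * real (n - last_index n + 1)) (1 / 2))) sequentially"
        using eventually_last_index_pos
      proof eventually_elim
        case (elim n)
        then show ?case using gamma[OF _ last_index_le] by simp
      qed
      have "(\<lambda>n. 1 - real (last_index n) / real n + 1 / real n) \<longlonglongrightarrow> 1 - T + 0"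
        by (intro tendsto_intros last_index_tendsto lim_1_over_n)
      moreover have "eventually (\<lambda>n. 1 - real (last_index n) / real n + 1 / real n =
          real (n - last_index n + 1) / real n) sequentially"
        using eventually_gt_at_top[of 0]
        by eventually_elim (simp add: of_nat_diff last_index_le field_simps)
      ultimately show "(\<lambda>n. real (n - last_index n + 1) / real n) \<longlonglongrightarrow> 1 - T"
        using Lim_transform_eventually by fastforce
    qed (use b T_less_1 c \<delta> \<open>\<epsilon> > 0\<close> in auto)
    ultimately show "eventually (\<lambda>n. exp (- (speed n * (rate x + \<epsilon>))) \<le>
        measure (distr M borel (log_avg (last_index n) n)) G) sequentially"
      using eventually_last_index_pos
    proof eventually_elim
      case (elim n)
      define m where "m = last_index n"
      have m: "m \<ge> 1" "m \<le> n" using elim last_index_le by (auto simp: m_def)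
      then have "n \<ge> 1" by simp
      have ins: "insert m {1..m - 1} = {1..m}" using m by auto
      \<comment> \<open>Independence of the summands makes the last one independent of the sum of
        the others, so the two lower bounds may be multiplied.\<close>
      have "indep_vars (\<lambda>_. borel) (\<lambda>k \<omega>. 1 / n * ln (\<rho> n k \<omega> / (2 * b * n))) {1..m}"
        by (rule indep_vars_compose2[OF indep_vars_subset[OF indep[OF \<open>n \<ge> 1\<close>]]]) (use m in auto)
      then have "indep_var borel (\<lambda>\<omega>. 1 / n * ln (\<rho> n m \<omega> / (2 * b * n)))
          borel (\<lambda>\<omega>. \<Sum>k\<in>{1..m - 1}. 1 / n * ln (\<rho> n k \<omega> / (2 * b * n)))"
        using m by (intro indep_vars_sum) (auto simp: ins simp del: One_nat_def)
      also have "(\<lambda>\<omega>. \<Sum>k\<in>{1..m - 1}. 1 / n * ln (\<rho> n k \<omega> / (2 * b * n))) = ?Y n"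
        by (simp add: log_avg_def m_def sum_distrib_left fun_eq_iff)
      also have "(\<lambda>\<omega>. 1 / n * ln (\<rho> n m \<omega> / (2 * b * n))) = Z n"
        by (simp add: Z_def m_def fun_eq_iff)
      finally have ind: "indep_var borel (Z n) borel (?Y n)" .
      have X: "log_avg m n \<omega> = Z n \<omega> + ?Y n \<omega>" for \<omega>
      proof -
        have "(\<Sum>k=1..m. ln (\<rho> n k \<omega> / (2 * b * n))) =
            ln (\<rho> n m \<omega> / (2 * b * n)) + (\<Sum>k=1..m - 1. ln (\<rho> n k \<omega> / (2 * b * n)))"
          unfolding ins[symmetric] using m by (subst sum.insert) auto
        then show ?thesis by (simp add: log_avg_def Z_def m_def distrib_left)
      qed
      have [measurable]: "random_variable borel (log_avg m n)"
        using m by (intro random_variable_log_avg)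
      have G: "G \<in> sets borel" using assms by simp
      have near: "{\<omega> \<in> space M. \<bar>W \<omega> - p\<bar> < r} = W -` ball p r \<inter> space M" for W p r
        by (auto simp: dist_real_def abs_minus_commute)
      have "exp (- (speed n * (rate x + \<epsilon>))) \<le>
          exp (- (speed n * ((1 - T) * c + \<epsilon> / 4))) * exp (- (speed n * (\<theta> * D \<theta> - L \<theta> + \<epsilon> / 4)))"
      proof -
        \<comment> \<open>Budget: the approximation of \<open>rate x\<close> costs less than
          \<open>\<epsilon> / 2\<close>, and each of the two probability bounds costs
          \<open>\<epsilon> / 4\<close>.\<close>
        have "speed n * (((1 - T) * c + \<epsilon> / 4) + (\<theta> * D \<theta> - L \<theta> + \<epsilon> / 4)) \<le> speed n * (rate x + \<epsilon>)"
          using \<theta>(3) b by (intro mult_left_mono) (auto simp: c_def)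
        then show ?thesis
          unfolding exp_add[symmetric] exp_le_cancel_iff distrib_left by linarith
      qed
      also have "\<dots> \<le> prob {\<omega> \<in> space M. \<bar>Z n \<omega> - (- c)\<bar> < \<delta> / 2} *
          prob {\<omega> \<in> space M. \<bar>?Y n \<omega> - D \<theta>\<bar> < \<delta> / 2}"
        using elim by (intro mult_mono) auto
      also have "\<dots> = prob (Z n -` ball (- c) (\<delta> / 2) \<inter> space M) *
          prob (?Y n -` ball (D \<theta>) (\<delta> / 2) \<inter> space M)"
        unfolding near ..
      also have "\<dots> = prob ((\<lambda>\<omega>. (Z n \<omega>, ?Y n \<omega>)) -` (ball (- c) (\<delta> / 2) \<times> ball (D \<theta>) (\<delta> / 2)) \<inter> space M)"
        by (rule indep_varD[OF ind, symmetric]) auto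
      also have "\<dots> \<le> prob (log_avg m n -` G \<inter> space M)"
      proof (intro finite_measure_mono subsetI)
        fix \<omega> assume \<omega>: "\<omega> \<in> (\<lambda>\<omega>. (Z n \<omega>, ?Y n \<omega>)) -` (ball (- c) (\<delta> / 2) \<times> ball (D \<theta>) (\<delta> / 2)) \<inter> space M"
        then have "\<bar>- c - Z n \<omega>\<bar> < \<delta> / 2" "\<bar>D \<theta> - ?Y n \<omega>\<bar> < \<delta> / 2"
          by (auto simp: dist_real_def)
        then have "\<bar>x - (Z n \<omega> + ?Y n \<omega>)\<bar> < \<delta>" unfolding c_def by linarith
        then have "log_avg m n \<omega> \<in> ball x \<delta>" by (simp add: X dist_real_def)
        with \<delta> \<omega> show "\<omega> \<in> log_avg m n -` G \<inter> space M" by auto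
      qed (use G in measurable)
      also have "\<dots> = measure (distr M borel (log_avg m n)) G"
        using G by (simp add: measure_distr)
      finally show ?case by (simp add: m_def)
    qed
  qed
  then have "- ?l \<le> (INF x\<in>G. ereal (rate x))"
    by (intro INF_greatest) (simp add: ereal_uminus_le_reorder)
  then show ?thesis by (simp only: ereal_uminus_le_reorder)
qed

lemma LDP_log_avg:
  "LDP (\<lambda>n. distr M borel (log_avg (last_index n) n)) speed (\<lambda>x. ereal (rate x))"
proof -
  interpret X: window_mgf T M speed "\<lambda>n. log_avg (last_index n) n"
    by (rule window_mgf_log_avg[OF last_index_bounds(1) last_index_tendsto])
  show ?thesis
    unfolding LDP_def using good_rate_function_rate X.ldp_upper_bound ldp_lower_bound by blast
qed

end

theorem theorem3p10:
  fixes M :: "'a measure" and \<rho> :: "nat \<Rightarrow> nat \<Rightarrow> 'a \<Rightarrow> real"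
    and \<beta> T :: real
  assumes "prob_space M"
    and "\<beta> > 0" and "0 < T" and "T < 1"
    and "\<And>n. n \<ge> 1 \<Longrightarrow> prob_space.indep_vars M (\<lambda>_. borel) (\<rho> n) {1..n}"
    and "\<And>n k. 1 \<le> k \<Longrightarrow> k \<le> n \<Longrightarrow>
           distributed M lborel (\<rho> n k) (gamma_density (\<beta> / 2 * real (n - k + 1)) (1 / 2))"
  shows "\<exists>I :: real \<Rightarrow> real.
     LDP (\<lambda>n. distr M borel (logDelta_scaled \<beta> T \<rho> n)) (\<lambda>n. \<beta> * (real n)\<^sup>2 / 2) (\<lambda>x. ereal (I x)) \<and>
     (\<forall>\<xi> \<ge> J_fun T - 1. \<exists>!\<theta>. \<theta> \<ge> -(1 - T) \<and> J_fun (1 + \<theta>) - J_fun (1 - T + \<theta>) = \<xi>) \<and>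
     (\<forall>\<xi> \<ge> J_fun T - 1. \<forall>\<theta>. \<theta> \<ge> -(1 - T) \<and> J_fun (1 + \<theta>) - J_fun (1 - T + \<theta>) = \<xi> \<longrightarrow>
         I \<xi> = \<theta> * \<xi> + F_fun 1 - F_fun (1 - T) - F_fun (1 + \<theta>) + F_fun (1 - T + \<theta>)) \<and>
     (\<forall>\<xi> < J_fun T - 1. I \<xi> = I (J_fun T - 1) + (1 - T) * ((J_fun T - 1) - \<xi>))"
proof -
  interpret log_gamma_window T M "\<beta> / 2" \<rho>
    using assms by (simp add: log_gamma_window_def window_def log_gamma_window_axioms_def)
  have "logDelta_scaled \<beta> T \<rho> n = log_avg (last_index n) n" for n
    by (simp add: logDelta_scaled_def log_avg_def last_index_def fun_eq_iff)
  then have ldp: "LDP (\<lambda>n. distr M borel (logDelta_scaled \<beta> T \<rho> n)) (\<lambda>n. \<beta> * (real n)\<^sup>2 / 2)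
      (\<lambda>x. ereal (rate x))"
    using LDP_log_avg by simp
  have ex1: "\<exists>!\<theta>. \<theta> \<ge> -(1 - T) \<and> J_fun (1 + \<theta>) - J_fun (1 - T + \<theta>) = \<xi>"
    if "\<xi> \<ge> J_fun T - 1" for \<xi>
    using D_ex1[of \<xi>] that unfolding D_\<theta>\<^sub>0 unfolding D_def \<theta>\<^sub>0_def by simp
  have above: "rate \<xi> = \<theta> * \<xi> + F_fun 1 - F_fun (1 - T) - F_fun (1 + \<theta>) + F_fun (1 - T + \<theta>)"
    if "\<xi> \<ge> J_fun T - 1" "\<theta> \<ge> -(1 - T) \<and> J_fun (1 + \<theta>) - J_fun (1 - T + \<theta>) = \<xi>" for \<xi> \<theta>
  proof -
    have "\<tau> \<xi> = \<theta>" using that by (intro \<tau>_eqI) (simp_all add: D_\<theta>\<^sub>0, simp_all add: D_def \<theta>\<^sub>0_def)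
    then show ?thesis by (simp add: rate_def L_def)
  qed
  have below: "rate \<xi> = rate (J_fun T - 1) + (1 - T) * ((J_fun T - 1) - \<xi>)"
    if "\<xi> < J_fun T - 1" for \<xi>
    \<comment> \<open>The optimal tilt is \<open>\<theta>\<^sub>0\<close> both at
      \<open>\<xi>\<close> and at the threshold, so \<open>rate\<close> is affine between them with
      slope \<open>- (1 - T)\<close>.\<close>
    using \<tau>_below[of \<xi>] \<tau>_below[of "J_fun T - 1"] that
    by (simp add: rate_def D_\<theta>\<^sub>0) (simp add: \<theta>\<^sub>0_def algebra_simps)
  from ldp ex1 above below show ?thesis by (intro exI[of _ rate]) blast
qed

end
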